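(* There exists a universal constant $C > 0$ such that for every integer $k \ge 1$, every $\delta \in (0,1]$ and every $d$, the following hold. (1) If $V^* \subset \mathbb{C}^d$ is a (finite) $\delta$-$\mathrm{SG}_k^*$ configuration, then $\operatorname{affine-dim}(V^* ) \leq C\,k/\delta$. (2) If $V \subset \mathbb{C}^d$ is a (finite) $\delta$-$\mathrm{SG}_k$ configuration, then $\operatorname{affine-dim}(V) \leq C^k/\delta$.
   Context: A $k$-flat is an affine subspace of $\mathbb{C}^d$ of (complex) dimension $k$. $\mathrm{fl}(v_1,\dots,v_k)$ denotes the affine span of $v_1,\dots,v_k$ (of dimension at most $k-1$). Points $v_1,\dots,v_k$ are independent if $\mathrm{fl}(v_1,\dots,v_k)$ has dimension exactly $k-1$. Fix a finite set $V \subset \mathbb{C}^d$ of size $n$. A $k$-flat is elementary (with respect to $V$) if its intersection with $V$ has exactly $k+1$ points. $V$ is a $\delta$-$\mathrm{SG}_k^*$ configuration if for every independent $v_1,\dots,v_k \in V$ there are at least $\delta n$ points $u \in V$ such that either $u \in \mathrm{fl}(v_1,\dots,v_k)$ or the $k$-flat $\mathrm{fl}(v_1,\dots,v_k,u)$ contains a point $w \in V$ outside $\mathrm{fl}(v_1,\dots,v_k) \cup \{u\}$. $V$ is a $\delta$-$\mathrm{SG}_k$ configuration if for every independent $v_1,\dots,v_k \in V$ there are at least $\delta n$ points $u \in V$ such that either $u \in \mathrm{fl}(v_1,\dots,v_k)$ or the $k$-flat $\mathrm{fl}(v_1,\dots,v_k,u)$ is not elementary. $\operatorname{affine-dim}(V)$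 is the (complex) dimension of the affine span of $V$. *)

theory Defs
  imports Complex_Main "HOL.Hull" "HOL-Library.Function_Algebras"
begin

text \<open>
  The constant in the theorem must not depend on the dimension $d$, so $d$ has to be a
  quantifiable natural number rather than an index type. Vectors are therefore functions
  \<^typ>\<open>nat \<Rightarrow> complex\<close>, and the space of dimension $d$ consists of those that vanish at all
  indices $i \ge d$. Addition and subtraction are pointwise; all linear and affine notions below
  are over the complex numbers (the library's \<open>affine\<close> and \<open>aff_dim\<close> are real).
\<close>

definition cspace :: "nat \<Rightarrow> (nat \<Rightarrow> complex) set" where
  "cspace d = {x. \<forall>i\<ge>d. x i = 0}"

definition cscale :: "complex \<Rightarrow> (nat \<Rightarrow> complex) \<Rightarrow> (nat \<Rightarrow> complex)" where
  "cscale c x = (\<lambda>i. c * x i)"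

global_interpretation cvec: vector_space cscale
  by unfold_locales (auto simp: cscale_def fun_eq_iff algebra_simps)

definition caffine :: "(nat \<Rightarrow> complex) set \<Rightarrow> bool" where
  "caffine A \<longleftrightarrow> (\<forall>x\<in>A. \<forall>y\<in>A. \<forall>a b. a + b = 1 \<longrightarrow> cscale a x + cscale b y \<in> A)"

definition fl :: "(nat \<Rightarrow> complex) set \<Rightarrow> (nat \<Rightarrow> complex) set" where
  "fl S = caffine hull S"

text \<open>
  The dimension of an affine subspace is that of its direction space; as with the library's
  \<open>aff_dim\<close>, the empty set has dimension $-1$.
\<close>

definition flat_dim :: "(nat \<Rightarrow> complex) set \<Rightarrow> int" where
  "flat_dim A = (if A = {} then -1 else int (cvec.dim {x - y |x y. x \<in> A \<and> y \<in> A}))"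

definition affine_dim :: "(nat \<Rightarrow> complex) set \<Rightarrow> int" where
  "affine_dim S = flat_dim (fl S)"

definition k_flat :: "nat \<Rightarrow> nat \<Rightarrow> (nat \<Rightarrow> complex) set \<Rightarrow> bool" where
  "k_flat d k F \<longleftrightarrow> F \<subseteq> cspace d \<and> caffine F \<and> flat_dim F = int k"

definition independent_points :: "(nat \<Rightarrow> complex) list \<Rightarrow> bool" where
  "independent_points vs \<longleftrightarrow> flat_dim (fl (set vs)) = int (length vs) - 1"

definition elementary ::
    "nat \<Rightarrow> nat \<Rightarrow> (nat \<Rightarrow> complex) set \<Rightarrow> (nat \<Rightarrow> complex) set \<Rightarrow> bool" where
  "elementary d k V F \<longleftrightarrow> k_flat d k F \<and> card (F \<inter> V) = k + 1"

definition SG_star :: "nat \<Rightarrow> nat \<Rightarrow> real \<Rightarrow> (nat \<Rightarrow> complex) set \<Rightarrow> bool" where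
  "SG_star d k \<delta> V \<longleftrightarrow> finite V \<and> V \<subseteq> cspace d \<and>
    (\<forall>vs. length vs = k \<and> set vs \<subseteq> V \<and> independent_points vs \<longrightarrow>
      real (card {u \<in> V. u \<in> fl (set vs) \<or>
                    (\<exists>w\<in>V. w \<in> fl (insert u (set vs)) \<and> w \<notin> fl (set vs) \<union> {u})})
        \<ge> \<delta> * real (card V))"

definition SG :: "nat \<Rightarrow> nat \<Rightarrow> real \<Rightarrow> (nat \<Rightarrow> complex) set \<Rightarrow> bool" where
  "SG d k \<delta> V \<longleftrightarrow> finite V \<and> V \<subseteq> cspace d \<and>
    (\<forall>vs. length vs = k \<and> set vs \<subseteq> V \<and> independent_points vs \<longrightarrow>
      real (card {u \<in> V. u \<in> fl (set vs) \<or> \<not> elementary d k V (fl (insert u (set vs)))})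
        \<ge> \<delta> * real (card V))"

end

(*
  Points are homogenized, so that flats become linear subspaces and collinear triples become linear
  relations. If every point of X lies on special lines with at least s others, the relations with
  suitable weights form a design matrix: each point owns rows of total weight 1, and every pair
  of columns meets in rows of total weight at most 6/s. Matrix scaling (an approximate minimum of a
  convex potential) makes all column sums nearly 1, and the Gram matrix H of the scaled columns then
  satisfies |I - H|^2 <= (6/s)|X| up to a small error. As I - H fixes the kernel of H, the rank of X
  is at most 6|X|/s.

  Part (1) follows by working modulo the span of a suitable list of fewer than k points. For part
  (2), induction on k shows that an SG_k configuration is an SG*_K configuration with
  K = C^(k-1) + 2: in the flat of any K independent points there is an elementary (k-1)-flat, and
  whatever its k points see outside the large flat, the K points see too.
*)
theory Submission imports Defs "HOL-Analysis.Convex" begin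

text \<open>Two obstacles shape the proof. In part (1), passing to the quotient by fewer than
  \<open>k\<close> points may merge points of the configuration, and a merged point no longer counts
  as a partner. The list is therefore chosen by pigeonhole: the points it sees are few, yet any
  further independent point raises the guaranteed number by \<open>\<delta> n / k\<close>. Working
  with this share instead of \<open>\<delta> n\<close> is what costs the factor \<open>k\<close>. In
  part (2), the flat of \<open>v_1, ..., v_k, u\<close> may fail to be elementary merely because the
  flat of \<open>v_1, ..., v_k\<close> already contains further points of \<open>V\<close>; then
  \<open>u\<close> need not take part in any relation. This is excluded for lists whose flat meets
  \<open>V\<close> in nothing but the list. Such a list is certain to exist inside any flat whose
  dimension exceeds the bound for the previous \<open>k\<close>, so each step of the induction
  multiplies the constant. Weights replace a balanced choice of collinear triples: lines of very
  different sizes can be mixed, because every point owns the same total weight.\<close>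

section \<open>Orthonormal systems and the multiplicity of the eigenvalue one\<close>

text \<open>Since the functions \<open>f b\<close> are dual to the points of \<open>P\<close>, Gram-Schmidt never meets a zero
  residue: the residue at \<open>b\<close> keeps the value \<open>f b b\<close>.\<close>
lemma gram_schmidt_diagonal:
  fixes f :: "'a \<Rightarrow> 'a \<Rightarrow> complex" and M :: "'a \<Rightarrow> 'a \<Rightarrow> complex"
  assumes fin: "finite X" and PX: "P \<subseteq> X"
    and diag: "\<And>b. b \<in> P \<Longrightarrow> f b b \<noteq> 0"
    and off: "\<And>b c. b \<in> P \<Longrightarrow> c \<in> P \<Longrightarrow> b \<noteq> c \<Longrightarrow> f b c = 0"
    and fix_f: "\<And>b i. b \<in> P \<Longrightarrow> i \<in> X \<Longrightarrow> (\<Sum>j\<in>X. M i j * f b j) = f b i"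
    and QP: "Q \<subseteq> P"
  shows "\<exists>e. (\<forall>b\<in>Q. \<forall>c\<in>Q. (\<Sum>x\<in>X. e b x * cnj (e c x)) = (if b = c then 1 else 0)) \<and>
             (\<forall>c\<in>Q. \<forall>b\<in>P - Q. e c b = 0) \<and>
             (\<forall>c\<in>Q. \<forall>i\<in>X. (\<Sum>j\<in>X. M i j * e c j) = e c i)"
proof -
  have "finite Q" using fin PX QP by (meson finite_subset)
  then show ?thesis using QP
  proof (induction Q rule: finite_induct)
    case empty
    show ?case by simp
  next
    case (insert b Q)
    then have "Q \<subseteq> P" by simp
    from insert.IH[OF this] obtain e where orth: "\<And>b c. b \<in> Q \<Longrightarrow> c \<in> Q \<Longrightarrow> (\<Sum>x\<in>X. e b x * cnj (e c x)) = (if b = c then 1 else 0)"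
      and zero: "\<And>b c. c \<in> Q \<Longrightarrow> b \<in> P - Q \<Longrightarrow> e c b = 0"
      and fix_e: "\<And>c i. c \<in> Q \<Longrightarrow> i \<in> X \<Longrightarrow> (\<Sum>j\<in>X. M i j * e c j) = e c i"
      by blast
    have bP: "b \<in> P" "b \<in> X" "b \<notin> Q" using insert PX by auto
    define \<alpha> where "\<alpha> c = (\<Sum>y\<in>X. f b y * cnj (e c y))" for c
    define g where "g x = f b x - (\<Sum>c\<in>Q. \<alpha> c * e c x)" for x
    define N where "N = sqrt (\<Sum>x\<in>X. (cmod (g x))\<^sup>2)"
    have gb: "g b = f b b" unfolding g_def using zero bP by simp
    have "0 < (\<Sum>x\<in>X. (cmod (g x))\<^sup>2)"
      by (rule sum_pos2[OF fin bP(2)]) (use gb diag bP in auto)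
    then have N: "N > 0" "N\<^sup>2 = (\<Sum>x\<in>X. (cmod (g x))\<^sup>2)" by (auto simp: N_def)
    have g_orth: "(\<Sum>x\<in>X. g x * cnj (e d x)) = 0" if "d \<in> Q" for d
    proof -
      have "(\<Sum>x\<in>X. g x * cnj (e d x)) = \<alpha> d - (\<Sum>x\<in>X. \<Sum>c\<in>Q. \<alpha> c * (e c x * cnj (e d x)))"
        by (simp add: g_def \<alpha>_def left_diff_distrib sum_subtractf sum_distrib_right mult.assoc)
      also have "(\<Sum>x\<in>X. \<Sum>c\<in>Q. \<alpha> c * (e c x * cnj (e d x))) = (\<Sum>c\<in>Q. \<alpha> c * (\<Sum>x\<in>X. e c x * cnj (e d x)))"
        by (subst sum.swap) (simp add: sum_distrib_left)
      also have "\<dots> = (\<Sum>c\<in>Q. \<alpha> c * (if c = d then 1 else 0))"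
        using orth that by (intro sum.cong) auto
      also have "\<dots> = \<alpha> d" using that insert.hyps(1) by (simp add: if_distrib cong: if_cong)
      finally show ?thesis by simp
    qed
    have g_orth': "(\<Sum>x\<in>X. e d x * cnj (g x)) = 0" if "d \<in> Q" for d
    proof -
      have "(\<Sum>x\<in>X. e d x * cnj (g x)) = cnj (\<Sum>x\<in>X. g x * cnj (e d x))" by (simp add: mult.commute)
      then show ?thesis using g_orth[OF that] by simp
    qed
    have g_norm: "(\<Sum>x\<in>X. g x * cnj (g x)) = of_real (N\<^sup>2)"
      by (simp add: N(2) complex_norm_square del: of_real_power)
    have g_fix: "(\<Sum>j\<in>X. M i j * g j) = g i" if i: "i \<in> X" for i
    proof -
      have "(\<Sum>j\<in>X. M i j * g j) = f b i - (\<Sum>j\<in>X. \<Sum>c\<in>Q. \<alpha> c * (M i j * e c j))"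
        using fix_f[OF bP(1) i]
        by (simp add: g_def right_diff_distrib sum_subtractf sum_distrib_left mult.assoc mult.left_commute)
      also have "(\<Sum>j\<in>X. \<Sum>c\<in>Q. \<alpha> c * (M i j * e c j)) = (\<Sum>c\<in>Q. \<alpha> c * (\<Sum>j\<in>X. M i j * e c j))"
        by (subst sum.swap) (simp add: sum_distrib_left)
      also have "\<dots> = (\<Sum>c\<in>Q. \<alpha> c * e c i)" using fix_e i by simp
      finally show ?thesis by (simp add: g_def)
    qed
    define e' where "e' = e(b := (\<lambda>x. g x / of_real N))"
    have e'b: "e' b = (\<lambda>x. g x / of_real N)" and e'Q: "\<And>c. c \<in> Q \<Longrightarrow> e' c = e c"
      using bP by (auto simp: e'_def)
    show ?case
    proof (intro exI[of _ e'] conjI ballI)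
      fix c d assume c: "c \<in> insert b Q" and d: "d \<in> insert b Q"
      show "(\<Sum>x\<in>X. e' c x * cnj (e' d x)) = (if c = d then 1 else 0)"
      proof (cases "c = b"; cases "d = b")
        assume cd: "c = b" "d = b"
        have "(\<Sum>x\<in>X. e' c x * cnj (e' d x)) = (\<Sum>x\<in>X. g x * cnj (g x)) / (of_real N)\<^sup>2"
          by (simp add: cd e'b sum_divide_distrib power2_eq_square)
        then show ?thesis using N(1) cd by (simp add: g_norm)
      next
        assume cd: "c = b" "d \<noteq> b"
        then have "(\<Sum>x\<in>X. e' c x * cnj (e' d x)) = (\<Sum>x\<in>X. g x * cnj (e d x)) / of_real N"
          using d by (simp add: e'b e'Q sum_divide_distrib)
        then show ?thesis using cd d g_orth by simp
      next
        assume cd: "c \<noteq> b" "d = b"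
        then have "(\<Sum>x\<in>X. e' c x * cnj (e' d x)) = (\<Sum>x\<in>X. e c x * cnj (g x)) / of_real N"
          using c by (simp add: e'b e'Q sum_divide_distrib)
        then show ?thesis using cd c g_orth' by simp
      next
        assume "c \<noteq> b" "d \<noteq> b"
        then show ?thesis using c d orth by (simp add: e'Q)
      qed
    next
      fix c x assume c: "c \<in> insert b Q" and x: "x \<in> P - insert b Q"
      show "e' c x = 0"
      proof (cases "c = b")
        case True
        have "(\<Sum>c\<in>Q. \<alpha> c * e c x) = 0" using zero x by (intro sum.neutral) auto
        moreover have "f b x = 0" using off bP x by auto
        ultimately show ?thesis using True by (simp add: e'b g_def)
      next
        case False
        then show ?thesis using c x zero by (auto simp: e'Q)
      qed
    next
      fix c i assume c: "c \<in> insert b Q" and i: "i \<in> X"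
      show "(\<Sum>j\<in>X. M i j * e' c j) = e' c i"
      proof (cases "c = b")
        case True
        have "(\<Sum>j\<in>X. M i j * (g j / of_real N)) = (\<Sum>j\<in>X. M i j * g j) / of_real N"
          by (simp add: sum_divide_distrib)
        then show ?thesis using True g_fix[OF i] by (simp add: e'b)
      next
        case False
        then show ?thesis using c i fix_e by (simp add: e'Q)
      qed
    qed
  qed
qed

lemma bessel_inequality:
  fixes e :: "'b \<Rightarrow> 'a \<Rightarrow> complex" and m :: "'a \<Rightarrow> complex"
  assumes fin: "finite P"
    and orth: "\<And>b c. b \<in> P \<Longrightarrow> c \<in> P \<Longrightarrow> (\<Sum>x\<in>X. e b x * cnj (e c x)) = (if b = c then 1 else 0)"
  shows "(\<Sum>p\<in>P. (cmod (\<Sum>x\<in>X. m x * cnj (e p x)))\<^sup>2) \<le> (\<Sum>x\<in>X. (cmod (m x))\<^sup>2)"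
proof -
  define c where "c p = (\<Sum>x\<in>X. m x * cnj (e p x))" for p
  define g where "g x = m x - (\<Sum>p\<in>P. c p * e p x)" for x
  have cnj_c: "(\<Sum>x\<in>X. e p x * cnj (m x)) = cnj (c p)" for p
    by (simp add: c_def mult.commute)
  have *: "(\<Sum>x\<in>X. g x * cnj (e q x)) = 0" if q: "q \<in> P" for q
  proof -
    have "(\<Sum>x\<in>X. g x * cnj (e q x)) = c q - (\<Sum>x\<in>X. \<Sum>p\<in>P. c p * (e p x * cnj (e q x)))"
      by (simp add: g_def c_def left_diff_distrib sum_subtractf sum_distrib_right mult.assoc)
    also have "(\<Sum>x\<in>X. \<Sum>p\<in>P. c p * (e p x * cnj (e q x))) = (\<Sum>p\<in>P. c p * (\<Sum>x\<in>X. e p x * cnj (e q x)))"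
      by (subst sum.swap) (simp add: sum_distrib_left)
    also have "\<dots> = (\<Sum>p\<in>P. c p * (if p = q then 1 else 0))"
      using orth q by (intro sum.cong) auto
    also have "\<dots> = c q" using q fin by (simp add: if_distrib cong: if_cong)
    finally show ?thesis by simp
  qed
  have "complex_of_real (\<Sum>x\<in>X. (cmod (g x))\<^sup>2) = (\<Sum>x\<in>X. g x * cnj (g x))"
    by (simp add: complex_norm_square del: of_real_power)
  also have "\<dots> = (\<Sum>x\<in>X. g x * cnj (m x)) - (\<Sum>x\<in>X. \<Sum>p\<in>P. cnj (c p) * (g x * cnj (e p x)))"
    by (subst (2) g_def) (simp add: right_diff_distrib sum_subtractf sum_distrib_left mult.assoc mult.left_commute)
  also have "(\<Sum>x\<in>X. \<Sum>p\<in>P. cnj (c p) * (g x * cnj (e p x))) = (\<Sum>p\<in>P. cnj (c p) * (\<Sum>x\<in>X. g x * cnj (e p x)))"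
    by (subst sum.swap) (simp add: sum_distrib_left)
  also have "\<dots> = 0" using * by simp
  also have "(\<Sum>x\<in>X. g x * cnj (m x)) = (\<Sum>x\<in>X. m x * cnj (m x)) - (\<Sum>x\<in>X. \<Sum>p\<in>P. c p * (e p x * cnj (m x)))"
    by (simp add: g_def left_diff_distrib sum_subtractf sum_distrib_right mult.assoc)
  also have "(\<Sum>x\<in>X. \<Sum>p\<in>P. c p * (e p x * cnj (m x))) = (\<Sum>p\<in>P. c p * cnj (c p))"
    by (subst sum.swap) (simp add: sum_distrib_left[symmetric] cnj_c)
  finally have "complex_of_real (\<Sum>x\<in>X. (cmod (g x))\<^sup>2) =
      complex_of_real ((\<Sum>x\<in>X. (cmod (m x))\<^sup>2) - (\<Sum>p\<in>P. (cmod (c p))\<^sup>2))"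
    by (simp add: complex_norm_square del: of_real_power)
  then have "(\<Sum>x\<in>X. (cmod (g x))\<^sup>2) = (\<Sum>x\<in>X. (cmod (m x))\<^sup>2) - (\<Sum>p\<in>P. (cmod (c p))\<^sup>2)"
    using of_real_eq_iff by blast
  moreover have "0 \<le> (\<Sum>x\<in>X. (cmod (g x))\<^sup>2)" by (simp add: sum_nonneg)
  ultimately show ?thesis by (simp add: c_def)
qed

text \<open>The sum of the squared norms of \<open>M e\<close> over an orthonormal system is at most
  the sum of the squared entries of \<open>M\<close>, by Bessel applied to each row; every fixed
  unit vector contributes one to it.\<close>

lemma eigenvalue_one_multiplicity_le:
  fixes f :: "'a \<Rightarrow> 'a \<Rightarrow> complex" and M :: "'a \<Rightarrow> 'a \<Rightarrow> complex"
  assumes fin: "finite X" and PX: "P \<subseteq> X"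
    and diag: "\<And>b. b \<in> P \<Longrightarrow> f b b \<noteq> 0"
    and off: "\<And>b c. b \<in> P \<Longrightarrow> c \<in> P \<Longrightarrow> b \<noteq> c \<Longrightarrow> f b c = 0"
    and fix_f: "\<And>b i. b \<in> P \<Longrightarrow> i \<in> X \<Longrightarrow> (\<Sum>j\<in>X. M i j * f b j) = f b i"
  shows "real (card P) \<le> (\<Sum>i\<in>X. \<Sum>j\<in>X. (cmod (M i j))\<^sup>2)"
proof -
  obtain e where orth: "\<And>b c. b \<in> P \<Longrightarrow> c \<in> P \<Longrightarrow> (\<Sum>x\<in>X. e b x * cnj (e c x)) = (if b = c then 1 else 0)"
    and fix_e: "\<And>c i. c \<in> P \<Longrightarrow> i \<in> X \<Longrightarrow> (\<Sum>j\<in>X. M i j * e c j) = e c i"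
    using gram_schmidt_diagonal[of X P f M P, OF fin PX diag off fix_f] by blast
  have finP: "finite P" using fin PX finite_subset by blast
  have unit: "(\<Sum>i\<in>X. (cmod (e p i))\<^sup>2) = 1" if "p \<in> P" for p
  proof -
    have "complex_of_real (\<Sum>i\<in>X. (cmod (e p i))\<^sup>2) = 1"
      using orth[OF that that] by (simp add: complex_norm_square del: of_real_power)
    then show ?thesis using of_real_eq_1_iff by blast
  qed
  have "real (card P) = (\<Sum>p\<in>P. \<Sum>i\<in>X. (cmod (e p i))\<^sup>2)" using unit by simp
  also have "\<dots> = (\<Sum>i\<in>X. \<Sum>p\<in>P. (cmod (\<Sum>j\<in>X. M i j * e p j))\<^sup>2)"
    by (subst sum.swap) (simp add: fix_e)
  also have "\<dots> \<le> (\<Sum>i\<in>X. \<Sum>j\<in>X. (cmod (M i j))\<^sup>2)"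
  proof (rule sum_mono)
    fix i
    \<comment> \<open>Applying \<open>M\<close> involves no conjugation of \<open>e p\<close>, so
      Bessel is used for the conjugated row.\<close>
    have "(\<Sum>p\<in>P. (cmod (\<Sum>x\<in>X. cnj (M i x) * cnj (e p x)))\<^sup>2) \<le> (\<Sum>x\<in>X. (cmod (cnj (M i x)))\<^sup>2)"
      by (rule bessel_inequality[OF finP orth])
    moreover have "cmod (\<Sum>x\<in>X. cnj (M i x) * cnj (e p x)) = cmod (\<Sum>x\<in>X. M i x * e p x)" for p
    proof -
      have "(\<Sum>x\<in>X. cnj (M i x) * cnj (e p x)) = cnj (\<Sum>x\<in>X. M i x * e p x)" by simp
      then show ?thesis by (metis complex_mod_cnj)
    qed
    ultimately show "(\<Sum>p\<in>P. (cmod (\<Sum>j\<in>X. M i j * e p j))\<^sup>2) \<le> (\<Sum>j\<in>X. (cmod (M i j))\<^sup>2)" by simp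
  qed
  finally show ?thesis .
qed

section \<open>Matrix scaling\<close>

text \<open>The bound \<open>ln c \<le> 2 * (sqrt c - 1)\<close> shows that the gap is at least
  \<open>(sqrt c - 1)\<^sup>2\<close>; the factor 3 bounds \<open>sqrt c + 1\<close>, as
  \<open>sqrt c \<le> 1 + \<eta> \<le> 2\<close>. This turns a small possible decrease of the
  potential into a column sum close to one.\<close>

lemma abs_minus_one_le_of_log_gap:
  fixes c \<eta> :: real
  assumes c: "c > 0" and gap: "c - 1 - ln c \<le> \<eta>\<^sup>2" and \<eta>: "0 < \<eta>" "\<eta> \<le> 1"
  shows "\<bar>c - 1\<bar> \<le> 3 * \<eta>"
proof -
  have "ln c = 2 * ln (sqrt c)" using c by (simp add: ln_sqrt)
  also have "\<dots> \<le> 2 * (sqrt c - 1)" using ln_le_minus_one[of "sqrt c"] c by simp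
  finally have "(sqrt c - 1)\<^sup>2 \<le> \<eta>\<^sup>2"
    using gap c by (simp add: power2_eq_square algebra_simps)
  then have *: "\<bar>sqrt c - 1\<bar> \<le> \<eta>" using \<eta>(1) abs_le_square_iff[of "sqrt c - 1" \<eta>] by simp
  have "c - 1 = (sqrt c - 1) * (sqrt c + 1)" using c by (simp add: algebra_simps)
  then have "\<bar>c - 1\<bar> = \<bar>sqrt c - 1\<bar> * (sqrt c + 1)" using c by (simp add: abs_mult)
  also have "\<dots> \<le> \<eta> * 3" using * \<eta> c by (intro mult_mono) auto
  finally show ?thesis by simp
qed

text \<open>Normalizing each row by its own sum keeps the row sums equal to one, so only the columns
  need work. The owners make the scaling possible: a row sum is never smaller than its term at the
  owner, which bounds the potential below, and the total weight one per owner is the target value of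
  the column sums.\<close>

lemma approximate_scaling:
  fixes X :: "'a set" and R :: "'r set" and \<mu> :: "'r \<Rightarrow> real" and own :: "'r \<Rightarrow> 'a"
    and a :: "'r \<Rightarrow> 'a \<Rightarrow> real"
  assumes finX: "finite X" and finR: "finite R"
    and \<mu>: "\<And>r. r \<in> R \<Longrightarrow> \<mu> r > 0"
    and own: "\<And>r. r \<in> R \<Longrightarrow> own r \<in> X" "\<And>r. r \<in> R \<Longrightarrow> a r (own r) > 0"
    and a: "\<And>r j. a r j \<ge> 0"
    and total: "\<And>j. j \<in> X \<Longrightarrow> (\<Sum>r | r \<in> R \<and> own r = j. \<mu> r) = 1"
    and \<eta>: "0 < \<eta>" "\<eta> \<le> 1"
  shows "\<exists>t. \<forall>j\<in>X. \<bar>(\<Sum>r\<in>R. \<mu> r * (a r j * exp (t j) / (\<Sum>i\<in>X. a r i * exp (t i)))) - 1\<bar> \<le> 3 * \<eta>"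
proof -
  define S where "S r t = (\<Sum>i\<in>X. a r i * exp (t i))" for r and t :: "'a \<Rightarrow> real"
  \<comment> \<open>The gradient of this convex function is the vector of column sums minus one. As its minimum
    need not be attained, a near-minimiser is used: rescaling column \<open>j\<close> by the inverse of its
    sum \<open>c\<close> lowers the value by at least \<open>c - 1 - ln c\<close>.\<close>
  define \<psi> where "\<psi> t = (\<Sum>r\<in>R. \<mu> r * (ln (S r t) - t (own r)))" for t
  define L where "L = (\<Sum>r\<in>R. \<mu> r * ln (a r (own r)))"
  have S_ge: "a r j * exp (t j) \<le> S r t" if "j \<in> X" for r j t
    unfolding S_def using that finX a by (intro member_le_sum) auto
  have S_pos: "S r t > 0" if "r \<in> R" for r t
    using S_ge[OF own(1)[OF that], of r t] own(2)[OF that] by (smt (verit) exp_gt_zero mult_pos_pos)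
  have \<psi>_ge: "L \<le> \<psi> t" for t
    unfolding L_def \<psi>_def
  proof (rule sum_mono)
    fix r assume r: "r \<in> R"
    have "ln (a r (own r)) + t (own r) = ln (a r (own r) * exp (t (own r)))"
      using own(2)[OF r] by (simp add: ln_mult)
    also have "\<dots> \<le> ln (S r t)"
      using S_ge[OF own(1)[OF r], of r t] own(2)[OF r] S_pos[OF r, of t] by (subst ln_le_cancel_iff) auto
    finally have "ln (a r (own r)) \<le> ln (S r t) - t (own r)" by simp
    then show "\<mu> r * ln (a r (own r)) \<le> \<mu> r * (ln (S r t) - t (own r))"
      using \<mu>[OF r] by (intro mult_left_mono) auto
  qed
  have bdd: "bdd_below (range \<psi>)" unfolding bdd_below_def using \<psi>_ge by auto
  have "Inf (range \<psi>) < Inf (range \<psi>) + \<eta>\<^sup>2" using \<eta> by simp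
  then obtain t where t: "\<psi> t < Inf (range \<psi>) + \<eta>\<^sup>2"
    using cInf_less_iff[OF _ bdd, of "Inf (range \<psi>) + \<eta>\<^sup>2"] by auto
  have near_min: "\<psi> t \<le> \<psi> t' + \<eta>\<^sup>2" for t'
    using t cInf_lower[OF _ bdd, of "\<psi> t'"] by simp
  show ?thesis
  proof (intro exI[of _ t] ballI)
    fix j assume j: "j \<in> X"
    define q where "q r = a r j * exp (t j) / S r t" for r
    define c where "c = (\<Sum>r\<in>R. \<mu> r * q r)"
    have q: "0 \<le> q r" "q r \<le> 1" if "r \<in> R" for r
      using S_ge[OF j, of r t] S_pos[OF that, of t] a[of r j] by (auto simp: q_def)
    have "\<exists>r\<in>R. own r = j"
    proof (rule ccontr)
      assume "\<not> ?thesis"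
      then have "{r. r \<in> R \<and> own r = j} = {}" by auto
      from total[OF j, unfolded this] show False by simp
    qed
    then obtain r0 where r0: "r0 \<in> R" "own r0 = j" by blast
    have c: "c > 0" unfolding c_def
    proof (rule sum_pos2[OF finR r0(1)])
      show "0 < \<mu> r0 * q r0"
        using \<mu>[OF r0(1)] own(2)[OF r0(1)] r0 S_pos[OF r0(1), of t] by (simp add: q_def)
      show "0 \<le> \<mu> r * q r" if "r \<in> R" for r using \<mu>[OF that] q[OF that] by simp
    qed
    define t' where "t' = t(j := t j - ln c)"
    have S': "S r t' = S r t * (1 + q r * (1 / c - 1))" if r: "r \<in> R" for r
    proof -
      have split: "S r u = a r j * exp (u j) + (\<Sum>i\<in>X - {j}. a r i * exp (u i))" for u
        unfolding S_def using finX j by (simp add: sum.remove)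
      have "(\<Sum>i\<in>X - {j}. a r i * exp (t' i)) = (\<Sum>i\<in>X - {j}. a r i * exp (t i))"
        by (intro sum.cong) (auto simp: t'_def)
      then have "S r t' = S r t + a r j * exp (t j) * (1 / c - 1)"
        using c split[of t'] split[of t] by (simp add: t'_def exp_diff algebra_simps)
      moreover have "a r j * exp (t j) = S r t * q r" using S_pos[OF r, of t] by (simp add: q_def)
      ultimately show ?thesis by (simp add: algebra_simps)
    qed
    \<comment> \<open>The sum of row \<open>r\<close> changes by the factor
      \<open>1 + q r * (1 / c - 1)\<close>, and \<open>ln (1 + x) \<le> x\<close> makes the change
      linear in \<open>q r\<close>; weighted over the rows it adds up to \<open>1 - c\<close>.
      Lowering \<open>t j\<close> by \<open>ln c\<close> gives back \<open>ln c\<close> exactly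
      once, since the rows owned by \<open>j\<close> have total weight one.\<close>
    have "\<psi> t' \<le> (\<Sum>r\<in>R. \<mu> r * (ln (S r t) - t (own r)) + (1 / c - 1) * (\<mu> r * q r)
        + ln c * (if own r = j then \<mu> r else 0))"
      unfolding \<psi>_def
    proof (rule sum_mono)
      fix r assume r: "r \<in> R"
      have pos: "1 + q r * (1 / c - 1) > 0"
        using S'[OF r] S_pos[OF r, of t'] S_pos[OF r, of t] by (metis zero_less_mult_pos)
      have "ln (S r t') = ln (S r t) + ln (1 + q r * (1 / c - 1))"
        using S'[OF r] S_pos[OF r, of t] pos by (simp add: ln_mult)
      also have "\<dots> \<le> ln (S r t) + q r * (1 / c - 1)"
        using ln_le_minus_one[OF pos] by simp
      finally have "ln (S r t') - t' (own r) \<le> ln (S r t) - t (own r) + q r * (1 / c - 1) + (if own r = j then ln c else 0)"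
        by (auto simp: t'_def)
      from mult_left_mono[OF this, of "\<mu> r"] \<mu>[OF r]
      show "\<mu> r * (ln (S r t') - t' (own r)) \<le> \<mu> r * (ln (S r t) - t (own r)) + (1 / c - 1) * (\<mu> r * q r)
        + ln c * (if own r = j then \<mu> r else 0)"
        by (auto simp: algebra_simps)
    qed
    also have "\<dots> = \<psi> t + (1 / c - 1) * c + ln c * (\<Sum>r\<in>R. if own r = j then \<mu> r else 0)"
      by (simp only: sum.distrib \<psi>_def c_def sum_distrib_left)
    also have "(\<Sum>r\<in>R. if own r = j then \<mu> r else 0) = 1"
      using total[OF j] finR by (simp add: sum.inter_filter)
    finally have "c - 1 - ln c \<le> \<eta>\<^sup>2"
      using near_min[of t'] c by (simp add: algebra_simps)
    from abs_minus_one_le_of_log_gap[OF c this \<eta>]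
    show "\<bar>(\<Sum>r\<in>R. \<mu> r * (a r j * exp (t j) / (\<Sum>i\<in>X. a r i * exp (t i)))) - 1\<bar> \<le> 3 * \<eta>"
      by (simp add: c_def q_def S_def)
  qed
qed

section \<open>The nullity of a weighted design matrix\<close>

text \<open>The vectors \<open>f b\<close> are independent kernel vectors, as their values on
  \<open>P\<close> form an invertible diagonal matrix. Scaling makes the rows unit vectors and the
  columns nearly so, which leaves little on the diagonal of \<open>I - H\<close>; an entry off the
  diagonal is the correlation of two columns, and only the rows meeting both contribute to
  it.\<close>

lemma design_nullity_le:
  fixes X :: "'a set" and R :: "'r set" and \<mu> :: "'r \<Rightarrow> real" and own :: "'r \<Rightarrow> 'a"
    and A :: "'r \<Rightarrow> 'a \<Rightarrow> complex" and f :: "'a \<Rightarrow> 'a \<Rightarrow> complex"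
  assumes finX: "finite X" and finR: "finite R"
    and \<mu>: "\<And>r. r \<in> R \<Longrightarrow> \<mu> r > 0"
    and own: "\<And>r. r \<in> R \<Longrightarrow> own r \<in> X" "\<And>r. r \<in> R \<Longrightarrow> A r (own r) \<noteq> 0"
    and total: "\<And>j. j \<in> X \<Longrightarrow> (\<Sum>r | r \<in> R \<and> own r = j. \<mu> r) = 1"
    and pair: "\<And>i j. i \<in> X \<Longrightarrow> j \<in> X \<Longrightarrow> i \<noteq> j \<Longrightarrow>
          (\<Sum>r | r \<in> R \<and> A r i \<noteq> 0 \<and> A r j \<noteq> 0. \<mu> r) \<le> \<tau>"
    and \<tau>: "\<tau> \<ge> 0"
    and PX: "P \<subseteq> X"
    and diag: "\<And>b. b \<in> P \<Longrightarrow> f b b \<noteq> 0"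
    and off: "\<And>b c. b \<in> P \<Longrightarrow> c \<in> P \<Longrightarrow> b \<noteq> c \<Longrightarrow> f b c = 0"
    and kernel: "\<And>b r. b \<in> P \<Longrightarrow> r \<in> R \<Longrightarrow> (\<Sum>j\<in>X. A r j * f b j) = 0"
  shows "real (card P) \<le> \<tau> * real (card X)"
proof -
  have total_\<mu>: "(\<Sum>r\<in>R. \<mu> r) = real (card X)"
  proof -
    have "(\<Sum>r\<in>R. \<mu> r) = (\<Sum>j\<in>X. \<Sum>r | r \<in> R \<and> own r = j. \<mu> r)"
      using own(1) by (intro sum.group[symmetric] finX finR) auto
    then show ?thesis using total by simp
  qed
  have step: "real (card P) \<le> 9 * real (card X) * \<eta>\<^sup>2 + \<tau> * real (card X)"
    if \<eta>: "0 < \<eta>" "\<eta> \<le> 1" for \<eta> :: real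
  proof -
    define a where "a r j = (cmod (A r j))\<^sup>2" for r j
    have "\<exists>t. \<forall>j\<in>X. \<bar>(\<Sum>r\<in>R. \<mu> r * (a r j * exp (t j) / (\<Sum>i\<in>X. a r i * exp (t i)))) - 1\<bar> \<le> 3 * \<eta>"
      by (rule approximate_scaling[of X R \<mu> own a \<eta>])
        (use finX finR \<mu> own total \<eta> in \<open>auto simp: a_def\<close>)
    then obtain t where t: "\<And>j. j \<in> X \<Longrightarrow> \<bar>(\<Sum>r\<in>R. \<mu> r * (a r j * exp (t j) / (\<Sum>i\<in>X. a r i * exp (t i)))) - 1\<bar> \<le> 3 * \<eta>"
      by blast
    define S where "S r = (\<Sum>i\<in>X. a r i * exp (t i))" for r
    have S_pos: "S r > 0" if "r \<in> R" for r unfolding S_def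
      by (rule sum_pos2[OF finX own(1)[OF that]]) (use own(2)[OF that] in \<open>auto simp: a_def\<close>)
    \<comment> \<open>The scaling concerned squared moduli, hence the half exponents; dividing by
      \<open>sqrt (S r)\<close> gives each row of \<open>B\<close> norm one.\<close>
    define B where "B r j = A r j * of_real (exp (t j / 2) / sqrt (S r))" for r j
    define H where "H i j = (\<Sum>r\<in>R. of_real (\<mu> r) * cnj (B r i) * B r j)" for i j
    \<comment> \<open>\<open>H\<close> is the Gram matrix of the scaled columns. It kills every \<open>f' b\<close>, which \<open>M\<close> therefore
      fixes, while the entries of \<open>M\<close> are small.\<close>
    define M where "M i j = (if i = j then 1 else 0) - H i j" for i j
    define f' where "f' b j = f b j * of_real (exp (- t j / 2))" for b j
    have B_norm: "(cmod (B r j))\<^sup>2 = a r j * exp (t j) / S r" if "r \<in> R" for r j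
    proof -
      have "(exp (t j / 2))\<^sup>2 = exp (t j)" by (simp add: power2_eq_square flip: exp_add)
      then show ?thesis using S_pos[OF that]
        by (simp add: B_def norm_mult norm_divide power_mult_distrib power_divide a_def)
    qed
    have B_sum: "(\<Sum>j\<in>X. (cmod (B r j))\<^sup>2) = 1" if "r \<in> R" for r
    proof -
      have "(\<Sum>j\<in>X. (cmod (B r j))\<^sup>2) = S r / S r"
        by (simp add: B_norm[OF that] S_def flip: sum_divide_distrib)
      then show ?thesis using S_pos[OF that] by simp
    qed
    have B_kernel: "(\<Sum>j\<in>X. B r j * f' b j) = 0" if "b \<in> P" "r \<in> R" for b r
    proof -
      have *: "complex_of_real (exp (t j / 2)) * complex_of_real (exp (- t j / 2)) = 1" for j
        by (simp flip: of_real_mult exp_add)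
      have "B r j * f' b j = A r j * f b j / of_real (sqrt (S r))" for j
      proof -
        have "B r j * f' b j = A r j * f b j * (complex_of_real (exp (t j / 2)) * complex_of_real (exp (- t j / 2))) / of_real (sqrt (S r))"
          by (simp add: B_def f'_def)
        then show ?thesis by (simp only: * mult_1_right)
      qed
      then have "(\<Sum>j\<in>X. B r j * f' b j) = (\<Sum>j\<in>X. A r j * f b j) / of_real (sqrt (S r))"
        by (simp add: sum_divide_distrib)
      then show ?thesis using kernel that by simp
    qed
    have H_kernel: "(\<Sum>j\<in>X. H i j * f' b j) = 0" if "b \<in> P" for b i
    proof -
      have "(\<Sum>j\<in>X. H i j * f' b j) = (\<Sum>j\<in>X. \<Sum>r\<in>R. (of_real (\<mu> r) * cnj (B r i)) * (B r j * f' b j))"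
        by (simp add: H_def sum_distrib_right mult.assoc)
      also have "\<dots> = (\<Sum>r\<in>R. (of_real (\<mu> r) * cnj (B r i)) * (\<Sum>j\<in>X. B r j * f' b j))"
        by (subst sum.swap) (simp add: sum_distrib_left)
      also have "\<dots> = 0" using B_kernel[OF that] by simp
      finally show ?thesis .
    qed
    have M_diag: "(cmod (M i i))\<^sup>2 \<le> 9 * \<eta>\<^sup>2" if i: "i \<in> X" for i
    proof -
      have "H i i = (\<Sum>r\<in>R. of_real (\<mu> r) * of_real ((cmod (B r i))\<^sup>2))"
        unfolding H_def by (intro sum.cong) (auto simp: complex_norm_square mult_ac simp del: of_real_power)
      also have "\<dots> = of_real (\<Sum>r\<in>R. \<mu> r * (cmod (B r i))\<^sup>2)" by simp
      also have "(\<Sum>r\<in>R. \<mu> r * (cmod (B r i))\<^sup>2) = (\<Sum>r\<in>R. \<mu> r * (a r i * exp (t i) / S r))"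
        by (intro sum.cong) (auto simp: B_norm)
      finally have "M i i = of_real (1 - (\<Sum>r\<in>R. \<mu> r * (a r i * exp (t i) / S r)))"
        by (simp add: M_def)
      then have "cmod (M i i) = \<bar>1 - (\<Sum>r\<in>R. \<mu> r * (a r i * exp (t i) / S r))\<bar>"
        by (simp only: norm_of_real)
      also have "\<dots> \<le> 3 * \<eta>" using t[OF i] unfolding S_def by simp
      finally have "(cmod (M i i))\<^sup>2 \<le> (3 * \<eta>)\<^sup>2" by (intro power_mono) auto
      then show ?thesis by (simp add: power_mult_distrib)
    qed
    \<comment> \<open>The squared moduli in each row sum to one, so the entries of \<open>W\<close>
      add up to the total row weight, which is \<open>card X\<close>.\<close>
    define W where "W i j = (\<Sum>r\<in>R. \<mu> r * ((cmod (B r i))\<^sup>2 * (cmod (B r j))\<^sup>2))" for i j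
    have W_nonneg: "W i j \<ge> 0" for i j
      unfolding W_def using \<mu> by (intro sum_nonneg mult_nonneg_nonneg) (auto simp: less_imp_le)
    have M_off: "(cmod (M i j))\<^sup>2 \<le> \<tau> * W i j" if ij: "i \<in> X" "j \<in> X" "i \<noteq> j" for i j
    proof -
      define R' where "R' = {r. r \<in> R \<and> A r i \<noteq> 0 \<and> A r j \<noteq> 0}"
      define x where "x r = cmod (B r i) * cmod (B r j)" for r
      have x0: "x r = 0" if "r \<in> R - R'" for r using that by (auto simp: x_def B_def R'_def)
      have R': "R' \<subseteq> R" by (auto simp: R'_def)
      have "cmod (M i j) \<le> (\<Sum>r\<in>R. cmod (of_real (\<mu> r) * cnj (B r i) * B r j))"
        using ij by (simp add: M_def H_def norm_sum)
      also have "\<dots> = (\<Sum>r\<in>R. \<mu> r * x r)"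
        using \<mu> by (intro sum.cong) (auto simp: norm_mult x_def less_imp_le)
      also have "\<dots> = (\<Sum>r\<in>R'. \<mu> r * x r)"
        using x0 R' finR by (intro sum.mono_neutral_right) auto
      \<comment> \<open>Splitting the weight into two square roots lets Cauchy-Schwarz separate the
        weight of the rows meeting both columns, at most \<open>\<tau>\<close>, from
        \<open>W i j\<close>.\<close>
      also have "\<dots> = (\<Sum>r\<in>R'. sqrt (\<mu> r) * (sqrt (\<mu> r) * x r))"
        using \<mu> R' by (intro sum.cong) (auto simp: less_imp_le simp flip: mult.assoc)
      finally have "(cmod (M i j))\<^sup>2 \<le> (\<Sum>r\<in>R'. sqrt (\<mu> r) * (sqrt (\<mu> r) * x r))\<^sup>2"
        by (intro power_mono) auto
      also have "\<dots> \<le> (\<Sum>r\<in>R'. (sqrt (\<mu> r))\<^sup>2) * (\<Sum>r\<in>R'. (sqrt (\<mu> r) * x r)\<^sup>2)"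
        by (rule Cauchy_Schwarz_ineq_sum)
      also have "(\<Sum>r\<in>R'. (sqrt (\<mu> r))\<^sup>2) = (\<Sum>r\<in>R'. \<mu> r)"
        using \<mu> R' by (intro sum.cong) (auto simp: less_imp_le)
      also have "(\<Sum>r\<in>R'. (sqrt (\<mu> r) * x r)\<^sup>2) = (\<Sum>r\<in>R'. \<mu> r * (x r)\<^sup>2)"
        using \<mu> R' by (intro sum.cong) (auto simp: less_imp_le power_mult_distrib)
      also have "\<dots> = (\<Sum>r\<in>R. \<mu> r * (x r)\<^sup>2)"
        using x0 R' finR by (intro sum.mono_neutral_left) auto
      also have "\<dots> = W i j" by (simp add: W_def x_def power_mult_distrib)
      also have "(\<Sum>r\<in>R'. \<mu> r) * W i j \<le> \<tau> * W i j"
        using pair[OF ij] W_nonneg[of i j] by (intro mult_right_mono) (auto simp: R'_def)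
      finally show ?thesis .
    qed
    have W_sum: "(\<Sum>i\<in>X. \<Sum>j\<in>X. W i j) = real (card X)"
    proof -
      have "(\<Sum>i\<in>X. \<Sum>j\<in>X. W i j) = (\<Sum>i\<in>X. \<Sum>r\<in>R. \<mu> r * ((cmod (B r i))\<^sup>2 * (\<Sum>j\<in>X. (cmod (B r j))\<^sup>2)))"
        unfolding W_def sum_distrib_left by (intro sum.cong refl sum.swap)
      also have "\<dots> = (\<Sum>i\<in>X. \<Sum>r\<in>R. \<mu> r * (cmod (B r i))\<^sup>2)"
        using B_sum by simp
      also have "\<dots> = (\<Sum>r\<in>R. \<mu> r * (\<Sum>i\<in>X. (cmod (B r i))\<^sup>2))"
        by (subst sum.swap) (simp add: sum_distrib_left)
      also have "\<dots> = (\<Sum>r\<in>R. \<mu> r)" using B_sum by simp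
      finally show ?thesis using total_\<mu> by simp
    qed
    have "real (card P) \<le> (\<Sum>i\<in>X. \<Sum>j\<in>X. (cmod (M i j))\<^sup>2)"
    proof (rule eigenvalue_one_multiplicity_le[OF finX PX, of f'])
      show "f' b b \<noteq> 0" if "b \<in> P" for b using diag[OF that] by (simp add: f'_def)
      show "f' b c = 0" if "b \<in> P" "c \<in> P" "b \<noteq> c" for b c using off[OF that] by (simp add: f'_def)
      show "(\<Sum>j\<in>X. M i j * f' b j) = f' b i" if "b \<in> P" "i \<in> X" for b i
      proof -
        have "(\<Sum>j\<in>X. M i j * f' b j) = (\<Sum>j\<in>X. if i = j then f' b j else 0) - (\<Sum>j\<in>X. H i j * f' b j)"
          unfolding sum_subtractf[symmetric] by (intro sum.cong) (auto simp: M_def algebra_simps)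
        then show ?thesis using H_kernel[OF that(1), of i] that(2) finX by simp
      qed
    qed
    also have "\<dots> \<le> (\<Sum>i\<in>X. \<Sum>j\<in>X. (if i = j then 9 * \<eta>\<^sup>2 else 0) + \<tau> * W i j)"
    proof (intro sum_mono)
      fix i j assume ij: "i \<in> X" "j \<in> X"
      have "0 \<le> \<tau> * W i j" using \<tau> W_nonneg by simp
      then show "(cmod (M i j))\<^sup>2 \<le> (if i = j then 9 * \<eta>\<^sup>2 else 0) + \<tau> * W i j"
        using M_diag[OF ij(1)] M_off[OF ij] by (cases "i = j") auto
    qed
    also have "\<dots> = (\<Sum>i\<in>X. 9 * \<eta>\<^sup>2) + \<tau> * (\<Sum>i\<in>X. \<Sum>j\<in>X. W i j)"
      using finX by (simp add: sum.distrib sum_distrib_left)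
    finally show ?thesis unfolding W_sum by (simp add: mult_ac)
  qed
  show ?thesis
  proof (rule field_le_epsilon)
    fix e :: real assume e: "0 < e"
    define D where "D = 9 * real (card X) + 1"
    define \<eta> where "\<eta> = min 1 (e / D)"
    have D: "D \<ge> 1" by (simp add: D_def)
    have \<eta>: "0 < \<eta>" "\<eta> \<le> 1" using e D by (auto simp: \<eta>_def)
    have "9 * real (card X) * \<eta>\<^sup>2 \<le> D * \<eta>\<^sup>2" by (intro mult_right_mono) (auto simp: D_def)
    also have "\<dots> \<le> D * \<eta>" using D \<eta> by (intro mult_left_mono) (auto simp: power2_eq_square mult_left_le)
    also have "\<dots> \<le> D * (e / D)" using D by (intro mult_left_mono) (auto simp: \<eta>_def)
    also have "\<dots> = e" using D by simp
    finally show "real (card P) \<le> \<tau> * real (card X) + e" using step[OF \<eta>] by simp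
  qed
qed

section \<open>Collinear triples modulo a subspace\<close>

lemma span_insert_exchange:
  assumes "w \<in> cvec.span (insert y Z)" "w \<notin> cvec.span Z"
  shows "cvec.span (insert w Z) = cvec.span (insert y Z)"
proof -
  have y: "y \<in> cvec.span (insert w Z)"
    using assms by (rule cvec.in_span_insert)
  show ?thesis
  proof (rule cvec.span_eq[THEN iffD2], intro conjI)
    show "insert w Z \<subseteq> cvec.span (insert y Z)"
      using assms(1) by (auto intro: cvec.span_base)
    show "insert y Z \<subseteq> cvec.span (insert w Z)"
      using y by (auto intro: cvec.span_base)
  qed
qed

text \<open>Modulo \<open>cvec.span Z\<close> the set \<open>X\<close> consists of distinct
  projective points, and \<open>partners\<close> counts the points \<open>u\<close> whose line
  through \<open>x\<close> carries a third point. The quotient is never formed: \<open>Z\<close> is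
  carried along inside the spans.\<close>

lemma sylvester_gallai_dim_le:
  fixes X Z :: "(nat \<Rightarrow> complex) set"
  assumes finX: "finite X" and finZ: "finite Z" and indZ: "cvec.independent Z"
    and outside: "\<And>x. x \<in> X \<Longrightarrow> x \<notin> cvec.span Z"
    and apart: "\<And>x y. x \<in> X \<Longrightarrow> y \<in> X \<Longrightarrow> x \<noteq> y \<Longrightarrow> y \<notin> cvec.span (insert x Z)"
    and s: "s > 0"
    and partners: "\<And>x. x \<in> X \<Longrightarrow>
      s \<le> real (card {u\<in>X. u \<noteq> x \<and> (\<exists>w\<in>X. w \<noteq> x \<and> w \<noteq> u \<and> w \<in> cvec.span (insert u (insert x Z)))})"
  shows "real (cvec.dim (X \<union> Z)) \<le> real (card Z) + 6 * real (card X) / s"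
proof -
  define L where "L x y = {w \<in> X. w \<in> cvec.span (insert y (insert x Z))}" for x y
  define T where "T x y = L x y - {x, y}" for x y
  define S where "S x = {u\<in>X. u \<noteq> x \<and> T x u \<noteq> {}}" for x
  have finL: "finite (L x y)" "finite (T x y)" "finite (S x)" for x y
    using finX by (auto simp: L_def S_def T_def)
  have L_commute: "L x y = L y x" for x y by (simp add: L_def insert_commute)
  have S_card: "s \<le> real (card (S x))" if "x \<in> X" for x
  proof -
    have "S x = {u\<in>X. u \<noteq> x \<and> (\<exists>w\<in>X. w \<noteq> x \<and> w \<noteq> u \<and> w \<in> cvec.span (insert u (insert x Z)))}"
      by (auto simp: S_def T_def L_def)
    then show ?thesis using partners[OF that] by simp
  qed
  have L_mem: "x \<in> L x y" "y \<in> L x y" if "x \<in> X" "y \<in> X" for x y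
    using that by (auto simp: L_def intro: cvec.span_base)
  \<comment> \<open>A line is determined by any two of its points, because no two points of
    \<open>X\<close> coincide modulo \<open>Z\<close>.\<close>
  have L_eq: "L x w = L x y" if "x \<in> X" "w \<in> X" "w \<in> L x y" "w \<noteq> x" for x y w
    using span_insert_exchange[of w y "insert x Z"] that apart[of x w] by (auto simp: L_def)
  have card_T: "card (T x y) = card (L x y) - 2" if "x \<in> X" "y \<in> X" "x \<noteq> y" for x y
    using L_mem[OF that(1,2)] that finL(1)[of x y] by (simp add: T_def card_Diff_subset)
  define R where "R = {(x, y, w). x \<in> X \<and> y \<in> X \<and> x \<noteq> y \<and> w \<in> T x y}"
  have R_sub: "R \<subseteq> X \<times> X \<times> X" by (auto simp: R_def T_def L_def)
  then have finR: "finite R" using finX by (meson finite_SigmaI finite_subset)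
  \<comment> \<open>Each point \<open>x\<close> distributes weight one evenly over its partners \<open>y\<close>, and then evenly over the
    third points of the line through \<open>x\<close> and \<open>y\<close>. A line with \<open>m + 2\<close> points thus carries rows of
    weight at most \<open>1 / (s * m)\<close>, and at most \<open>6 * m\<close> of them contain a given pair.\<close>
  define \<mu> where "\<mu> r = (case r of (x, y, w) \<Rightarrow> 1 / (real (card (S x)) * real (card (T x y))))" for r :: "(nat \<Rightarrow> complex) \<times> (nat \<Rightarrow> complex) \<times> (nat \<Rightarrow> complex)"
  have \<mu>_pos: "\<mu> r > 0" if "r \<in> R" for r
  proof -
    obtain x y w where r: "r = (x, y, w)" "x \<in> X" "w \<in> T x y" using \<open>r \<in> R\<close> by (auto simp: R_def)
    have "card (S x) > 0" using S_card[OF r(2)] s by simp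
    moreover have "card (T x y) > 0" using r(3) finL by (auto simp: card_gt_0_iff)
    ultimately show ?thesis by (simp add: \<mu>_def r(1))
  qed
  have total: "(\<Sum>r | r \<in> R \<and> fst r = x. \<mu> r) = 1" if x: "x \<in> X" for x
  proof -
    have inj: "inj_on (\<lambda>(y, w). (x, y, w)) (SIGMA y:S x. T x y)" by (auto simp: inj_on_def)
    have eq: "{r. r \<in> R \<and> fst r = x} = (\<lambda>(y, w). (x, y, w)) ` (SIGMA y:S x. T x y)"
      using x by (force simp: R_def S_def)
    have "(\<Sum>r | r \<in> R \<and> fst r = x. \<mu> r) = (\<Sum>(y, w)\<in>(SIGMA y:S x. T x y). \<mu> (x, y, w))"
      unfolding eq by (subst sum.reindex[OF inj]) (simp add: case_prod_beta)
    also have "\<dots> = (\<Sum>y\<in>S x. \<Sum>w\<in>T x y. \<mu> (x, y, w))"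
      using finL by (subst sum.Sigma) auto
    also have "\<dots> = (\<Sum>y\<in>S x. 1 / real (card (S x)))"
    proof (intro sum.cong refl)
      fix y assume "y \<in> S x"
      then have "card (T x y) > 0" using finL by (auto simp: S_def card_gt_0_iff)
      then show "(\<Sum>w\<in>T x y. \<mu> (x, y, w)) = 1 / real (card (S x))" by (simp add: \<mu>_def)
    qed
    also have "\<dots> = 1" using S_card[OF x] s by simp
    finally show ?thesis .
  qed
  \<comment> \<open>The row of a triple is its linear relation modulo \<open>cvec.span Z\<close>.
    The owner \<open>x\<close> has a nonzero coefficient, since otherwise \<open>w\<close> would
    coincide with \<open>y\<close> projectively modulo \<open>Z\<close>.\<close>
  have "\<exists>a. \<forall>r\<in>R. case r of (x, y, w) \<Rightarrow> fst (a r) \<noteq> 0 \<and>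
      w - cscale (snd (a r)) y - cscale (fst (a r)) x \<in> cvec.span Z"
  proof (rule bchoice[where Q = "\<lambda>r a. case r of (x, y, w) \<Rightarrow> fst a \<noteq> 0 \<and>
      w - cscale (snd a) y - cscale (fst a) x \<in> cvec.span Z"], rule ballI)
    fix r assume "r \<in> R"
    then obtain x y w where r: "r = (x, y, w)" "x \<in> X" "y \<in> X" "x \<noteq> y" "w \<in> T x y"
      by (auto simp: R_def)
    then have w: "w \<in> X" "w \<noteq> x" "w \<noteq> y" "w \<in> cvec.span (insert y (insert x Z))"
      by (auto simp: T_def L_def)
    obtain k l where kl: "w - cscale k y - cscale l x \<in> cvec.span Z"
      using w(4) unfolding cvec.span_breakdown_eq by blast
    have "l \<noteq> 0"
    proof
      assume "l = 0"
      then have "w \<in> cvec.span (insert y Z)"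
        using kl unfolding cvec.span_breakdown_eq by (auto simp: cvec.scale_zero_left)
      then show False using apart[of y w] r w by auto
    qed
    then show "\<exists>a. case r of (x, y, w) \<Rightarrow> fst a \<noteq> 0 \<and>
        w - cscale (snd a) y - cscale (fst a) x \<in> cvec.span Z"
      using kl r(1) by (intro exI[of _ "(l, k)"]) simp
  qed
  then obtain a where a: "\<And>x y w. (x, y, w) \<in> R \<Longrightarrow> fst (a (x, y, w)) \<noteq> 0 \<and>
      w - cscale (snd (a (x, y, w))) y - cscale (fst (a (x, y, w))) x \<in> cvec.span Z"
    by fastforce
  define A where "A r v = (case r of (x, y, w) \<Rightarrow>
      if v = x then - fst (a r) else if v = y then - snd (a r) else if v = w then 1 else 0)"
    for r and v :: "nat \<Rightarrow> complex"
  have A_support: "v = x \<or> v = y \<or> v = w" if "A (x, y, w) v \<noteq> 0" for x y w v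
    using that by (auto simp: A_def split: if_splits)
  have pair: "(\<Sum>r | r \<in> R \<and> A r i \<noteq> 0 \<and> A r j \<noteq> 0. \<mu> r) \<le> 6 / s"
    if ij: "i \<in> X" "j \<in> X" "i \<noteq> j" for i j
  proof -
    define Q where "Q = {r. r \<in> R \<and> A r i \<noteq> 0 \<and> A r j \<noteq> 0}"
    define m where "m = card (T i j)"
    \<comment> \<open>\<open>i\<close> and \<open>j\<close> take two of the three places of the
      triple, in either order, and the remaining place runs over \<open>T i j\<close>: three choices
      of the free place times two orders give the factor six. All these triples lie on one line and
      so share the cardinality \<open>m\<close>.\<close>
    have cases: "((x = i \<and> y = j \<or> x = j \<and> y = i) \<and> w \<in> T i j \<or>
        (x = i \<and> w = j \<or> x = j \<and> w = i) \<and> y \<in> T i j \<or>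
        (y = i \<and> w = j \<or> y = j \<and> w = i) \<and> x \<in> T i j) \<and> card (T x y) = m"
      if "(x, y, w) \<in> Q" for x y w
    proof -
      have xyw: "x \<in> X" "y \<in> X" "x \<noteq> y" "w \<in> L x y" "w \<noteq> x" "w \<noteq> y" "w \<in> X"
        using that by (auto simp: Q_def R_def T_def L_def)
      have "A (x, y, w) i \<noteq> 0" "A (x, y, w) j \<noteq> 0" using that by (auto simp: Q_def)
      from this[THEN A_support] have mem: "i \<in> {x, y, w}" "j \<in> {x, y, w}" by auto
      have "L x w = L x y" using L_eq[of x w y] xyw by simp
      moreover have "L y w = L x y" using L_eq[of y w x] L_commute[of x y] xyw by simp
      ultimately have "L i j = L x y"
        using mem ij(3) L_commute by auto
      moreover have "x \<in> L x y" "y \<in> L x y" using L_mem xyw by auto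
      ultimately show ?thesis
        using mem ij xyw by (auto simp: m_def card_T) (auto simp: T_def)
    qed
    define G where "G = (\<lambda>w. (i, j, w)) ` T i j \<union> (\<lambda>w. (j, i, w)) ` T i j \<union> (\<lambda>y. (i, y, j)) ` T i j
      \<union> (\<lambda>y. (j, y, i)) ` T i j \<union> (\<lambda>x. (x, i, j)) ` T i j \<union> (\<lambda>x. (x, j, i)) ` T i j"
    have QG: "Q \<subseteq> G"
    proof
      fix r assume r: "r \<in> Q"
      obtain x y w where xyw: "r = (x, y, w)" by (cases r)
      show "r \<in> G" using cases[of x y w] r unfolding xyw G_def by blast
    qed
    have card_image: "card (g ` T i j) \<le> m" for g :: "(nat \<Rightarrow> complex) \<Rightarrow> (nat \<Rightarrow> complex) \<times> (nat \<Rightarrow> complex) \<times> (nat \<Rightarrow> complex)"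
      unfolding m_def by (rule card_image_le[OF finL(2)])
    have "card G \<le> m + m + m + m + m + m"
      unfolding G_def by (intro order.trans[OF card_Un_le] add_mono card_image)
    moreover have "finite G" using finL by (auto simp: G_def)
    ultimately have card_Q: "card Q \<le> 6 * m" using card_mono[OF _ QG] by linarith
    have \<mu>_le: "\<mu> r \<le> 1 / (s * real m)" if r: "r \<in> Q" for r
    proof -
      obtain x y w where xyw: "r = (x, y, w)" by (cases r)
      have "x \<in> X" "w \<in> T x y" using r by (auto simp: xyw Q_def R_def)
      moreover have Tm: "card (T x y) = m" using cases[of x y w] r xyw by simp
      ultimately have "m > 0" using finL by (auto simp: card_gt_0_iff)
      then show ?thesis using S_card[OF \<open>x \<in> X\<close>] s
        by (auto simp: xyw \<mu>_def Tm intro!: divide_left_mono mult_right_mono mult_pos_pos)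
    qed
    have "(\<Sum>r\<in>Q. \<mu> r) \<le> real (card Q) * (1 / (s * real m))"
      using sum_bounded_above[of Q \<mu> "1 / (s * real m)"] \<mu>_le by simp
    also have "\<dots> \<le> real (6 * m) * (1 / (s * real m))"
      using card_Q s by (intro mult_right_mono) auto
    \<comment> \<open>For \<open>m = 0\<close> the left side is zero.\<close>
    also have "\<dots> \<le> 6 / s" using s by (cases "m = 0") auto
    finally show ?thesis by (simp add: Q_def)
  qed
  obtain B where B: "Z \<subseteq> B" "B \<subseteq> X \<union> Z" "cvec.independent B" "X \<union> Z \<subseteq> cvec.span B"
    using cvec.maximal_independent_subset_extend[of Z "X \<union> Z"] indZ by auto
  have finB: "finite B" using B(2) finX finZ by (meson finite_UnI finite_subset)
  have dimB: "cvec.dim (X \<union> Z) = card B" using cvec.basis_card_eq_dim B by metis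
  define P where "P = B - Z"
  \<comment> \<open>The coordinates on \<open>B\<close> outside \<open>Z\<close> are linear functionals vanishing on \<open>Z\<close>, so the
    collinearities are relations among their values.\<close>
  define f where "f b x = cvec.representation B x b" for b x
  have "real (card P) \<le> 6 / s * real (card X)"
  proof (rule design_nullity_le[where own = fst and A = A and f = f, OF finX finR \<mu>_pos])
    show "fst r \<in> X" if "r \<in> R" for r using that by (auto simp: R_def)
    show "A r (fst r) \<noteq> 0" if "r \<in> R" for r using that a by (cases r) (auto simp: A_def)
    show "(\<Sum>r | r \<in> R \<and> fst r = x. \<mu> r) = 1" if "x \<in> X" for x using total[OF that] .
    show "(\<Sum>r | r \<in> R \<and> A r i \<noteq> 0 \<and> A r j \<noteq> 0. \<mu> r) \<le> 6 / s" if "i \<in> X" "j \<in> X" "i \<noteq> j" for i j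
      using pair[OF that] .
    show "0 \<le> 6 / s" using s by simp
    show "P \<subseteq> X" using B by (auto simp: P_def)
    show "f b b \<noteq> 0" if "b \<in> P" for b
      using that cvec.representation_basis[OF B(3), of b] by (simp add: f_def P_def)
    show "f b c = 0" if "b \<in> P" "c \<in> P" "b \<noteq> c" for b c
      using that cvec.representation_basis[OF B(3), of c] by (simp add: f_def P_def)
    show "(\<Sum>j\<in>X. A r j * f b j) = 0" if b: "b \<in> P" and r: "r \<in> R" for b r
    proof -
      obtain x y w where xyw: "r = (x, y, w)" by (cases r)
      have X3: "x \<in> X" "y \<in> X" "w \<in> X" "x \<noteq> y" "w \<noteq> x" "w \<noteq> y"
        using r by (auto simp: xyw R_def T_def L_def)
      let ?k = "snd (a r)" and ?l = "fst (a r)"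
      have inB: "x \<in> cvec.span B" "y \<in> cvec.span B" "w \<in> cvec.span B" using X3 B by auto
      have "w - cscale ?k y - cscale ?l x \<in> cvec.span Z" using a r by (auto simp: xyw)
      then have "cvec.representation B (w - cscale ?k y - cscale ?l x) b = 0"
        using cvec.representation_extend[OF B(3) _ B(1)] cvec.representation_ne_zero[of Z _ b] b
        by (metis DiffD2 P_def)
      then have *: "f b w - ?k * f b y - ?l * f b x = 0"
        using B(3) inB by (simp add: f_def cvec.representation_diff cvec.representation_scale
          cvec.span_diff cvec.span_scale)
      have "(\<Sum>j\<in>X. A r j * f b j) = (\<Sum>j\<in>{x, y, w}. A r j * f b j)"
        using X3 finX by (intro sum.mono_neutral_right) (auto simp: A_def xyw)
      also have "\<dots> = f b w - ?k * f b y - ?l * f b x"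
        using X3 by (simp add: A_def xyw)
      finally show ?thesis using * by simp
    qed
  qed
  moreover have "card B = card Z + card P"
    unfolding P_def using B(1) finB finZ by (simp add: card_Diff_subset card_mono)
  ultimately show ?thesis by (simp add: dimB)
qed

section \<open>Starred configurations in linear form\<close>

text \<open>\<open>D I\<close> is the set of points seen by \<open>I\<close>. If
  \<open>\<delta> n / k\<close> is below 2, the trivial bound \<open>n\<close> on the dimension
  suffices; otherwise \<open>\<delta> n / k - 1\<close>, the number of partners that survive in the
  quotient, is at least half of \<open>\<delta> n / k\<close>.\<close>

lemma linear_sg_star_dim_le:
  fixes W :: "(nat \<Rightarrow> complex) set" and \<delta> :: real and k :: nat
  defines "D I \<equiv> {u\<in>W. u \<in> cvec.span I \<or>
      (\<exists>w\<in>W. w \<in> cvec.span (insert u I) \<and> w \<notin> cvec.span I \<and> w \<noteq> u)}"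
  assumes finW: "finite W" and nonzero: "0 \<notin> W"
    and apart: "\<And>x y. x \<in> W \<Longrightarrow> y \<in> W \<Longrightarrow> x \<noteq> y \<Longrightarrow> y \<notin> cvec.span {x}"
    and k: "k \<ge> 1" and \<delta>: "0 < \<delta>" "\<delta> \<le> 1"
    and star: "\<And>I. I \<subseteq> W \<Longrightarrow> cvec.independent I \<Longrightarrow> card I = k \<Longrightarrow> \<delta> * real (card W) \<le> real (card (D I))"
  shows "real (cvec.dim W) \<le> 13 * real k / \<delta>"
proof (cases "\<delta> * real (card W) / real k \<ge> 2")
  case False
  have "real (card W) \<le> 2 * real k / \<delta>" using False k \<delta> by (simp add: field_simps)
  moreover have "real (cvec.dim W) \<le> real (card W)" using cvec.dim_le_card'[OF finW] by simp
  moreover have "2 * real k / \<delta> \<le> 13 * real k / \<delta>" using k \<delta> by (simp add: divide_right_mono)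
  ultimately show ?thesis by linarith
next
  case True
  define n where "n = real (card W)"
  define \<beta> where "\<beta> = \<delta> * n / real k"
  have \<beta>: "\<beta> \<ge> 2" using True by (simp add: \<beta>_def n_def)
  \<comment> \<open>At the first \<open>j\<close> where all the sets \<open>D I\<close> are large, some \<open>I\<close> of size \<open>j - 1\<close> has a small one.
    Modulo the span of \<open>I\<close>, every point then has about \<open>\<beta>\<close> partners outside \<open>D I\<close>, and those are
    alone in their classes.\<close>
  define Q where "Q j \<longleftrightarrow> j \<ge> 1 \<and> (\<forall>I. I \<subseteq> W \<and> cvec.independent I \<and> card I = j \<longrightarrow> \<beta> * real j \<le> real (card (D I)))" for j
  have Qk: "Q k" using star k by (auto simp: Q_def \<beta>_def n_def)
  define j where "j = (LEAST j. Q j)"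
  have Qj: "Q j" unfolding j_def using Qk by (rule LeastI)
  have jk: "j \<le> k" unfolding j_def using Qk by (rule Least_le)
  have finD: "finite (D I)" for I using finW by (simp add: D_def)
  have "\<exists>I\<subseteq>W. cvec.independent I \<and> card I = j - 1 \<and> real (card (D I)) \<le> \<beta> * real (j - 1)"
  proof (cases "j = 1")
    case True
    \<comment> \<open>The pigeonhole starts from zero: no vector of \<open>W\<close> is zero and no
      two of them are proportional, so the empty list sees nothing.\<close>
    have "D {} = {}"
      using nonzero apart by (auto simp: D_def)
    then show ?thesis using True by (intro exI[of _ "{}"]) (auto simp: cvec.independent_empty)
  next
    case False
    have "j \<ge> 1" using Qj by (simp add: Q_def)
    then have "j - 1 < (LEAST j. Q j)" unfolding j_def[symmetric] by simp
    then have "\<not> Q (j - 1)" by (rule not_less_Least)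
    then show ?thesis using False \<open>j \<ge> 1\<close> by (auto simp: Q_def intro: less_imp_le)
  qed
  then obtain I where I: "I \<subseteq> W" "cvec.independent I" "card I = j - 1"
    and DI: "real (card (D I)) \<le> \<beta> * real (j - 1)" by blast
  have finI: "finite I" using I(1) finW finite_subset by blast
  define U where "U = W - cvec.span I"
  \<comment> \<open>The choice depends on the span only, so points of the same class modulo
    \<open>I\<close> get literally the same representative.\<close>
  define rep where "rep x = (SOME y. y \<in> U \<and> cvec.span (insert y I) = cvec.span (insert x I))" for x
  have rep: "rep x \<in> U" "cvec.span (insert (rep x) I) = cvec.span (insert x I)" if "x \<in> U" for x
  proof -
    have "\<exists>y. y \<in> U \<and> cvec.span (insert y I) = cvec.span (insert x I)" using that by blast
    from someI_ex[OF this] show "rep x \<in> U" "cvec.span (insert (rep x) I) = cvec.span (insert x I)"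
      by (auto simp: rep_def)
  qed
  have rep_cong: "rep x = rep y" if "cvec.span (insert x I) = cvec.span (insert y I)" for x y
    using that by (simp add: rep_def)
  define X where "X = rep ` U"
  have XU: "X \<subseteq> U" using rep by (auto simp: X_def)
  have finX: "finite X" using finW by (simp add: X_def U_def)
  have rep_X: "rep x = x" if "x \<in> X" for x
  proof -
    obtain u where u: "u \<in> U" "x = rep u" using \<open>x \<in> X\<close> by (auto simp: X_def)
    show ?thesis unfolding u(2) by (rule rep_cong[OF rep(2)[OF u(1)]])
  qed
  have alone: "w = u" if "u \<in> W" "u \<notin> D I" "w \<in> U" "w \<in> cvec.span (insert u I)" for u w
    using that by (auto simp: D_def U_def)
  have good: "u \<in> U" "u \<in> X" if "u \<in> W" "u \<notin> D I" for u
  proof -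
    show u: "u \<in> U" using that by (auto simp: D_def U_def)
    have "rep u \<in> cvec.span (insert (rep u) I)" by (intro cvec.span_base) simp
    then have "rep u = u" using alone[OF that rep(1)[OF u]] rep(2)[OF u] by simp
    then show "u \<in> X" using u by (force simp: X_def)
  qed
  have partners: "\<beta> - 1 \<le> real (card {u\<in>X. u \<noteq> x \<and>
      (\<exists>w\<in>X. w \<noteq> x \<and> w \<noteq> u \<and> w \<in> cvec.span (insert u (insert x I)))})" (is "_ \<le> real (card ?P)")
    if x: "x \<in> X" for x
  proof -
    have xU: "x \<in> W" "x \<notin> cvec.span I" "x \<in> U" using XU x by (auto simp: U_def)
    then have "x \<notin> I" using cvec.span_base by blast
    have "cvec.independent (insert x I)" using I(2) xU by (simp add: cvec.independent_insertI)
    moreover have "card (insert x I) = j"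
      using \<open>x \<notin> I\<close> finI I(3) Qj by (simp add: Q_def)
    ultimately have Dx: "\<beta> * real j \<le> real (card (D (insert x I)))"
      using Qj I(1) xU by (simp add: Q_def)
    \<comment> \<open>The point \<open>x\<close> itself is no partner; removing it accounts for the
      1 in \<open>\<beta> - 1\<close>.\<close>
    define E where "E = D (insert x I) - D I - {x}"
    have "D (insert x I) \<subseteq> E \<union> D I \<union> {x}" by (auto simp: E_def)
    then have "card (D (insert x I)) \<le> card (E \<union> D I \<union> {x})"
      using finD by (intro card_mono) (auto simp: E_def)
    also have "\<dots> \<le> card E + card (D I) + 1"
      by (rule order.trans[OF card_Un_le]) (use card_Un_le[of E "D I"] in simp)
    finally have "real (card (D (insert x I))) \<le> real (card E) + real (card (D I)) + 1" by linarith
    moreover have "\<beta> * real j - \<beta> * real (j - 1) = \<beta>" using Qj by (simp add: Q_def of_nat_diff algebra_simps)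
    ultimately have "\<beta> - 1 \<le> real (card E)" using Dx DI by linarith
    also have "card E \<le> card ?P"
    proof (rule card_mono)
      show "finite ?P" using finX by simp
      show "E \<subseteq> ?P"
      proof
        fix u assume "u \<in> E"
        then have u: "u \<in> W" "u \<notin> D I" "u \<noteq> x" "u \<in> D (insert x I)" by (auto simp: E_def D_def)
        have uU: "u \<in> U" "u \<in> X" using good u by auto
        have "u \<notin> cvec.span (insert x I)"
        proof
          assume "u \<in> cvec.span (insert x I)"
          then have "x \<in> cvec.span (insert u I)"
            using cvec.in_span_insert uU(1) by (auto simp: U_def)
          then show False using alone[OF u(1,2) xU(3)] u(3) by simp
        qed
        then obtain w where w: "w \<in> W" "w \<in> cvec.span (insert u (insert x I))"
            "w \<notin> cvec.span (insert x I)" "w \<noteq> u"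
          using u(4) by (auto simp: D_def)
        have "w \<notin> cvec.span I"
          using w(3) cvec.span_mono[of I "insert x I"] by auto
        then have wU: "w \<in> U" using w(1) by (simp add: U_def)
        \<comment> \<open>The third point \<open>w\<close> is replaced by its representative, which
          lies on the same line modulo \<open>I\<close>. It differs from \<open>x\<close> because
          \<open>w\<close> is outside \<open>cvec.span (insert x I)\<close>, and from
          \<open>u\<close> because \<open>u\<close> shares its class with no other point.\<close>
        have w_in: "w \<in> cvec.span (insert (rep w) I)"
          unfolding rep(2)[OF wU] by (intro cvec.span_base) simp
        have "rep w \<in> cvec.span (insert (rep w) I)" by (intro cvec.span_base) simp
        then have "rep w \<in> cvec.span (insert w I)" using rep(2)[OF wU] by simp
        moreover have "cvec.span (insert w I) \<subseteq> cvec.span (insert u (insert x I))"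
          using w(2) by (intro cvec.span_minimal) (auto intro: cvec.span_base cvec.subspace_span)
        ultimately have "rep w \<in> cvec.span (insert u (insert x I))" by blast
        moreover have "rep w \<noteq> x" using w_in w(3) by auto
        moreover have "rep w \<noteq> u" using w_in alone[OF u(1,2) wU] w(4) by auto
        moreover have "rep w \<in> X" using wU by (simp add: X_def)
        ultimately show "u \<in> ?P" using uU u(3) by blast
      qed
    qed
    finally show ?thesis by simp
  qed
  have "real (cvec.dim (X \<union> I)) \<le> real (card I) + 6 * real (card X) / (\<beta> - 1)"
  proof (rule sylvester_gallai_dim_le[OF finX finI I(2) _ _ _ partners])
    show "x \<notin> cvec.span I" if "x \<in> X" for x using that XU by (auto simp: U_def)
    show "y \<notin> cvec.span (insert x I)" if "x \<in> X" "y \<in> X" "x \<noteq> y" for x y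
    proof
      assume "y \<in> cvec.span (insert x I)"
      then have "cvec.span (insert y I) = cvec.span (insert x I)"
        using that XU by (intro span_insert_exchange) (auto simp: U_def)
      from rep_cong[OF this] show False using that rep_X[of x] rep_X[of y] by metis
    qed
    show "\<beta> - 1 > 0" using \<beta> by simp
  qed
  \<comment> \<open>The constant 13 arises here: one \<open>k / \<delta>\<close> for the points of
    \<open>I\<close>, and twice six from \<open>\<beta> - 1 \<ge> \<beta> / 2\<close>.\<close>
  also have "\<dots> \<le> real k / \<delta> + 12 * real k / \<delta>"
  proof (rule add_mono)
    have "real (card I) \<le> real k" using I(3) jk by simp
    also have "\<dots> \<le> real k / \<delta>" using \<delta> mult_left_le_one_le[of "real k" \<delta>] by (simp add: field_simps)
    finally show "real (card I) \<le> real k / \<delta>" .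
    have "card X \<le> card W" unfolding X_def U_def
      using card_image_le[of "W - cvec.span I" rep] card_mono[of W "W - cvec.span I"] finW by simp
    then have "6 * real (card X) / (\<beta> - 1) \<le> 6 * n / (\<beta> / 2)"
      using \<beta> by (intro frac_le) (auto simp: n_def)
    also have "\<dots> = 12 * real k / \<delta>"
    proof -
      have "n \<noteq> 0" using \<beta> by (auto simp: \<beta>_def)
      then show ?thesis using k \<delta> by (simp add: \<beta>_def field_simps)
    qed
    finally show "6 * real (card X) / (\<beta> - 1) \<le> 12 * real k / \<delta>" .
  qed
  also have "\<dots> = 13 * real k / \<delta>" by (simp add: add_divide_distrib[symmetric])
  finally have dim: "real (cvec.dim (X \<union> I)) \<le> 13 * real k / \<delta>" .
  obtain B where B: "B \<subseteq> X \<union> I" "cvec.independent B" "X \<union> I \<subseteq> cvec.span B" "card B = cvec.dim (X \<union> I)"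
    using cvec.basis_exists by blast
  have "W \<subseteq> cvec.span (X \<union> I)"
  proof
    fix w assume w: "w \<in> W"
    show "w \<in> cvec.span (X \<union> I)"
    proof (cases "w \<in> cvec.span I")
      case True
      then show ?thesis using cvec.span_mono[of I "X \<union> I"] by auto
    next
      case False
      then have wU: "w \<in> U" using w by (simp add: U_def)
      have "w \<in> cvec.span (insert (rep w) I)"
        unfolding rep(2)[OF wU] by (intro cvec.span_base) simp
      moreover have "insert (rep w) I \<subseteq> X \<union> I" using wU by (auto simp: X_def)
      ultimately show ?thesis using cvec.span_mono by blast
    qed
  qed
  also have "\<dots> \<subseteq> cvec.span B" using B(3) by (intro cvec.span_minimal) auto
  finally have "cvec.dim W \<le> card B"
    using B(1) finX finI by (intro cvec.dim_le_card) (auto intro: finite_subset)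
  then show ?thesis using B(4) dim by simp
qed

section \<open>Homogenization of affine flats\<close>

text \<open>The extra coordinate is put in front because functions on all natural numbers have no
  last coordinate; this keeps the construction independent of \<open>d\<close>.\<close>

definition hom :: "(nat \<Rightarrow> complex) \<Rightarrow> nat \<Rightarrow> complex" where
  "hom x = case_nat 1 x"

lemma hom_0 [simp]: "hom x 0 = 1" and hom_Suc [simp]: "hom x (Suc i) = x i"
  by (simp_all add: hom_def)

lemma inj_hom: "inj_on hom A"
  by (rule inj_onI) (metis ext hom_Suc)

text \<open>As \<open>caffine\<close> speaks of two points at a time, the sum of two directions is
  reached through their midpoint, stretched by the factor 2.\<close>

lemma subspace_caffine_directions:
  assumes A: "caffine A" and s: "s \<in> A"
  shows "cvec.subspace {v. s + v \<in> A}"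
proof -
  have scale: "s + cscale c v \<in> A" if "s + v \<in> A" for c v
  proof -
    have "cscale (1 - c) s + cscale c (s + v) \<in> A"
      using A s that unfolding caffine_def by (metis diff_add_cancel)
    then show ?thesis by (simp add: cscale_def plus_fun_def algebra_simps)
  qed
  have add: "s + (v + w) \<in> A" if "s + v \<in> A" "s + w \<in> A" for v w
  proof -
    have "cscale (1/2) (s + v) + cscale (1/2) (s + w) \<in> A"
    proof -
      have "1/2 + 1/2 = (1::complex)" by simp
      then show ?thesis using A that unfolding caffine_def by blast
    qed
    moreover have "cscale (1/2) (s + v) + cscale (1/2) (s + w) = s + cscale (1/2) (v + w)"
      by (auto simp: cscale_def fun_eq_iff field_simps)
    ultimately have "s + cscale 2 (cscale (1/2) (v + w)) \<in> A" using scale by metis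
    then show ?thesis by (simp add: cvec.scale_scale cvec.scale_one)
  qed
  show ?thesis using s scale add by (auto simp: cvec.subspace_def)
qed

lemma caffine_fl: "caffine (fl S)"
  unfolding fl_def by (rule hull_in) (auto simp: caffine_def)

lemma subset_fl: "S \<subseteq> fl S"
  by (simp add: fl_def hull_subset)

lemma fl_minimal: "S \<subseteq> A \<Longrightarrow> caffine A \<Longrightarrow> fl S \<subseteq> A"
  by (simp add: fl_def hull_minimal)

lemma fl_empty: "fl {} = {}"
  using fl_minimal[of "{}" "{}"] by (auto simp: caffine_def)

lemma mem_fl_iff: "x \<in> fl S \<longleftrightarrow> hom x \<in> cvec.span (hom ` S)"
proof
  have "caffine {x. hom x \<in> cvec.span (hom ` S)}"
    unfolding caffine_def
  proof (intro ballI allI impI)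
    fix x y and a b :: complex
    assume xy: "x \<in> {x. hom x \<in> cvec.span (hom ` S)}" "y \<in> {x. hom x \<in> cvec.span (hom ` S)}"
      and ab: "a + b = 1"
    have "hom (cscale a x + cscale b y) = cscale a (hom x) + cscale b (hom y)"
      using ab by (auto simp: fun_eq_iff cscale_def hom_def split: nat.splits)
    then show "cscale a x + cscale b y \<in> {x. hom x \<in> cvec.span (hom ` S)}"
      using xy by (simp add: cvec.span_add cvec.span_scale)
  qed
  then have "fl S \<subseteq> {x. hom x \<in> cvec.span (hom ` S)}"
    by (intro fl_minimal) (auto intro: cvec.span_base)
  then show "x \<in> fl S \<Longrightarrow> hom x \<in> cvec.span (hom ` S)" by auto
next
  assume x: "hom x \<in> cvec.span (hom ` S)"
  have "S \<noteq> {}"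
  proof
    assume "S = {}"
    then have "hom x = 0" using x by (simp add: cvec.span_empty)
    then show False using hom_0[of x] by (simp del: hom_0)
  qed
  then obtain s where s: "s \<in> S" by blast
  define D where "D = {v. s + v \<in> fl S}"
  have D: "cvec.subspace D"
    unfolding D_def using s subset_fl by (intro subspace_caffine_directions caffine_fl) auto
  \<comment> \<open>\<open>g\<close> is the linear map sending \<open>hom y\<close> to
    \<open>y - s\<close>, so it carries the span of the homogenized points into the direction space
    of the flat.\<close>
  define g where "g y = (\<lambda>i. y (Suc i)) - cscale (y 0) s" for y :: "nat \<Rightarrow> complex"
  have g_add: "g (y + z) = g y + g z" and g_scale: "g (cscale c y) = cscale c (g y)" for y z c
    by (auto simp: g_def fun_eq_iff cscale_def algebra_simps)
  have g_hom: "s + g (hom y) = y" for y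
    by (auto simp: g_def fun_eq_iff cscale_def)
  have "g 0 = 0" by (auto simp: g_def fun_eq_iff cscale_def)
  then have "cvec.subspace {y. g y \<in> D}"
    using D by (auto simp: cvec.subspace_def g_add g_scale)
  moreover have "hom ` S \<subseteq> {y. g y \<in> D}"
    using subset_fl[of S] by (auto simp: D_def g_hom)
  ultimately have "cvec.span (hom ` S) \<subseteq> {y. g y \<in> D}" by (rule cvec.span_minimal[rotated])
  then have "g (hom x) \<in> D" using x by auto
  then show "x \<in> fl S" by (simp add: D_def g_hom)
qed

lemma fl_insert_exchange:
  assumes "w \<in> fl (insert u S)" "w \<notin> fl S"
  shows "u \<in> fl (insert w S)"
  using assms cvec.in_span_insert by (simp add: mem_fl_iff)

lemma fl_singleton: "fl {v} = {v}"
proof -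
  have "caffine {v}"
    by (auto simp: caffine_def cscale_def fun_eq_iff simp flip: distrib_right)
  then show ?thesis using fl_minimal[of "{v}" "{v}"] subset_fl[of "{v}"] by auto
qed

lemma dim_insert_new:
  assumes "finite S" "x \<notin> cvec.span S"
  shows "cvec.dim (insert x S) = cvec.dim S + 1"
proof -
  obtain B where B: "B \<subseteq> S" "cvec.independent B" "S \<subseteq> cvec.span B" "card B = cvec.dim S"
    using cvec.basis_exists by blast
  have finB: "finite B" using B assms finite_subset by blast
  have "x \<notin> cvec.span B" using assms(2) cvec.span_mono[OF B(1)] by blast
  then have ind: "cvec.independent (insert x B)" "x \<notin> B"
    using B(2) by (auto simp: cvec.independent_insertI intro: cvec.span_base)
  have "insert x S \<subseteq> cvec.span (insert x B)"
    using B(3) cvec.span_mono[of B "insert x B"] by (auto intro: cvec.span_base)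
  then have "card (insert x B) = cvec.dim (insert x S)"
    using B(1) ind by (intro cvec.basis_card_eq_dim) auto
  then show ?thesis using finB ind B(4) by simp
qed

text \<open>A basis of the directions together with one homogenized point is a basis of the
  homogenized span, which therefore has one dimension more. For empty \<open>S\<close> both sides
  are -1.\<close>

lemma flat_dim_fl:
  assumes fin: "finite S"
  shows "flat_dim (fl S) = int (cvec.dim (hom ` S)) - 1"
proof (cases "S = {}")
  case True
  have "cvec.dim {} = 0" using cvec.dim_eq_card_independent[OF cvec.independent_empty] by simp
  then show ?thesis using True by (simp add: fl_empty flat_dim_def)
next
  case False
  then obtain s where s: "s \<in> S" by blast
  then have sfl: "s \<in> fl S" using subset_fl by blast
  define D where "D = {v. s + v \<in> fl S}"
  have D: "cvec.subspace D"
    unfolding D_def using sfl by (intro subspace_caffine_directions caffine_fl)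
  have diffs: "{x - y |x y. x \<in> fl S \<and> y \<in> fl S} = D"
  proof (intro equalityI subsetI)
    fix v assume "v \<in> {x - y |x y. x \<in> fl S \<and> y \<in> fl S}"
    then obtain x y where v: "v = x - y" "x - s \<in> D" "y - s \<in> D" by (auto simp: D_def)
    then have "(x - s) - (y - s) \<in> D" using D cvec.subspace_diff by blast
    then show "v \<in> D" by (simp add: v(1))
  next
    fix v assume "v \<in> D"
    then have "s + v \<in> fl S" by (simp add: D_def)
    then have "v = (s + v) - s \<and> s + v \<in> fl S \<and> s \<in> fl S" using sfl by simp
    then have "\<exists>x y. v = x - y \<and> x \<in> fl S \<and> y \<in> fl S" by (intro exI)
    then show "v \<in> {x - y |x y. x \<in> fl S \<and> y \<in> fl S}" by simp
  qed
  \<comment> \<open>directions are the points at infinity, of zeroth coordinate 0\<close>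
  define e where "e v = case_nat 0 v" for v :: "nat \<Rightarrow> complex"
  have hom_add: "hom (s + v) = hom s + e v" for v
    by (auto simp: e_def hom_def fun_eq_iff split: nat.splits)
  have e0: "e v 0 = 0" for v by (simp add: e_def)
  interpret e: vector_space_pair cscale cscale ..
  have lin: "Vector_Spaces.linear cscale cscale e"
    by unfold_locales (auto simp: e_def cscale_def fun_eq_iff split: nat.splits)
  have inj: "inj e"
  proof (rule injI)
    fix v w assume "e v = e w"
    then have "e v (Suc i) = e w (Suc i)" for i by simp
    then show "v = w" by (simp add: e_def fun_eq_iff)
  qed
  obtain B where B: "B \<subseteq> D" "cvec.independent B" "D \<subseteq> cvec.span B" "card B = cvec.dim D"
    using cvec.basis_exists by blast
  have ind_e: "cvec.independent (e ` B)"
    using e.linear_independent_injective_image[OF lin B(2)] inj by (simp add: inj_on_subset)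
  have "cvec.span (e ` B) \<subseteq> {v. v 0 = 0}"
    by (rule cvec.span_minimal) (auto simp: e0 cvec.subspace_def cscale_def)
  moreover have "hom s \<notin> {v. v 0 = 0}" by simp
  ultimately have new: "hom s \<notin> cvec.span (e ` B)" by (rule contra_subsetD)
  then have new': "hom s \<notin> e ` B" using cvec.span_base by metis
  have ind: "cvec.independent (insert (hom s) (e ` B))"
    using ind_e new by (simp add: cvec.independent_insertI)
  have sub: "insert (hom s) (e ` B) \<subseteq> cvec.span (hom ` S)"
  proof -
    have "e v \<in> cvec.span (hom ` S)" if "v \<in> B" for v
    proof -
      have "hom (s + v) \<in> cvec.span (hom ` S)" using that B(1) by (auto simp: D_def mem_fl_iff)
      moreover have "hom s \<in> cvec.span (hom ` S)" using s by (intro cvec.span_base) auto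
      ultimately have "hom (s + v) - hom s \<in> cvec.span (hom ` S)" by (rule cvec.span_diff)
      then show ?thesis by (simp add: hom_add)
    qed
    moreover have "hom s \<in> cvec.span (hom ` S)" using s by (intro cvec.span_base) simp
    ultimately show ?thesis by blast
  qed
  have super: "hom ` S \<subseteq> cvec.span (insert (hom s) (e ` B))"
  proof
    fix y assume "y \<in> hom ` S"
    then obtain x where x: "x \<in> S" "y = hom x" by blast
    then have "x - s \<in> D" using subset_fl by (auto simp: D_def)
    then have "e (x - s) \<in> cvec.span (e ` B)"
      using B(3) e.linear_span_image[OF lin, of B] by auto
    then have "e (x - s) \<in> cvec.span (insert (hom s) (e ` B))"
      using cvec.span_mono[of "e ` B" "insert (hom s) (e ` B)"] by auto
    moreover have "hom s \<in> cvec.span (insert (hom s) (e ` B))" by (intro cvec.span_base) simp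
    ultimately have "hom s + e (x - s) \<in> cvec.span (insert (hom s) (e ` B))" by (simp add: cvec.span_add)
    then show "y \<in> cvec.span (insert (hom s) (e ` B))" using hom_add[of "x - s"] x(2) by simp
  qed
  \<comment> \<open>An infinite set has \<open>card\<close> 0, so the basis must be known to be
    finite before its elements are counted.\<close>
  have "finite (insert (hom s) (e ` B))"
    using cvec.independent_span_bound[OF _ ind sub] fin by simp
  then have "finite (e ` B)" by simp
  then have finB: "finite B" using inj by (meson finite_imageD inj_on_subset subset_UNIV)
  have "cvec.dim (hom ` S) = card (insert (hom s) (e ` B))"
    using cvec.basis_card_eq_dim[OF sub cvec.span_minimal[OF super cvec.subspace_span] ind]
    by (simp add: cvec.dim_span)
  also have "\<dots> = card B + 1"
    using new' finB card_image[OF inj_on_subset[OF inj]] by simp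
  finally have "int (cvec.dim (hom ` S)) - 1 = int (cvec.dim D)" using B(4) by simp
  moreover have "fl S \<noteq> {}" using sfl by blast
  ultimately show ?thesis by (simp only: flat_dim_def diffs if_False)
qed

section \<open>Dimension bounds for both kinds of configurations\<close>

text \<open>The common zeroth coordinate 1 makes the homogenized points nonzero and pairwise
  non-proportional, and the points seen by a list correspond under \<open>hom\<close>, so the linear
  bound applies.\<close>

lemma SG_star_affine_dim_le:
  assumes SG: "SG_star d k \<delta> V" and k: "k \<ge> 1" and \<delta>: "0 < \<delta>" "\<delta> \<le> 1"
  shows "real_of_int (affine_dim V) \<le> 13 * real k / \<delta>"
proof -
  have finV: "finite V" using SG by (simp add: SG_star_def)
  define W where "W = hom ` V"
  have card_hom: "card (hom ` A) = card A" for A by (rule card_image[OF inj_hom])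
  have "real (cvec.dim W) \<le> 13 * real k / \<delta>"
  proof (rule linear_sg_star_dim_le[OF _ _ _ k \<delta>])
    show "finite W" using finV by (simp add: W_def)
    show "0 \<notin> W"
    proof
      assume "0 \<in> W"
      then obtain v where "hom v = 0" by (auto simp: W_def)
      then have "hom v 0 = 0" by simp
      then show False by simp
    qed
    show "y \<notin> cvec.span {x}" if "x \<in> W" "y \<in> W" "x \<noteq> y" for x y
    proof
      assume "y \<in> cvec.span {x}"
      then obtain c where c: "y = cscale c x" by (auto simp: cvec.span_singleton)
      have "x 0 = 1" "y 0 = 1" using that by (auto simp: W_def)
      then have "c = 1" using c by (simp add: cscale_def)
      then show False using c that(3) by (simp add: cvec.scale_one)
    qed
    fix I assume I: "I \<subseteq> W" "cvec.independent I" "card I = k"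
    obtain A where A: "A \<subseteq> V" "I = hom ` A" using I(1) unfolding W_def by (meson subset_imageE)
    have "finite A" using A(1) finV finite_subset by blast
    then obtain vs where vs: "set vs = A" "distinct vs" using finite_distinct_list by blast
    have len: "length vs = k" using vs I(3) A(2) card_hom distinct_card by metis
    have "independent_points vs"
      unfolding independent_points_def vs(1) len flat_dim_fl[OF \<open>finite A\<close>] A(2)[symmetric]
        cvec.dim_eq_card_independent[OF I(2)] I(3) ..
    then have "\<delta> * real (card V) \<le> real (card {u \<in> V. u \<in> fl A \<or>
        (\<exists>w\<in>V. w \<in> fl (insert u A) \<and> w \<notin> fl A \<union> {u})})"
      using SG len vs(1) A(1) unfolding SG_star_def by blast
    moreover have "{u \<in> W. u \<in> cvec.span I \<or>
        (\<exists>w\<in>W. w \<in> cvec.span (insert u I) \<and> w \<notin> cvec.span I \<and> w \<noteq> u)} =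
      hom ` {u \<in> V. u \<in> fl A \<or> (\<exists>w\<in>V. w \<in> fl (insert u A) \<and> w \<notin> fl A \<union> {u})}"
      using inj_hom[of UNIV] by (auto simp: W_def A(2) mem_fl_iff inj_def)
    ultimately show "\<delta> * real (card W) \<le> real (card {u \<in> W. u \<in> cvec.span I \<or>
        (\<exists>w\<in>W. w \<in> cvec.span (insert u I) \<and> w \<notin> cvec.span I \<and> w \<noteq> u)})"
      by (simp add: card_hom W_def)
  qed
  then show ?thesis using flat_dim_fl[OF finV] by (simp add: affine_dim_def W_def)
qed

text \<open>The flat of \<open>u\<close> and \<open>zs\<close> has the dimension required of an
  elementary flat, so failing to be elementary means containing a point of \<open>V\<close> beyond
  these. As \<open>fl (set zs)\<close> meets \<open>V\<close> only in \<open>zs\<close>, that point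
  is outside it: this is how the plain notion yields the starred one.\<close>

lemma non_elementary_witness:
  assumes V: "finite V" "V \<subseteq> cspace d"
    and zs: "set zs \<subseteq> V" "independent_points zs" "V \<inter> fl (set zs) = set zs"
    and u: "u \<in> V" "u \<notin> fl (set zs)"
    and non: "\<not> elementary d (length zs) V (fl (insert u (set zs)))"
  shows "\<exists>w\<in>V. w \<in> fl (insert u (set zs)) \<and> w \<notin> fl (set zs) \<union> {u}"
proof -
  have dim: "cvec.dim (hom ` set zs) = length zs"
    using zs(2) by (simp add: independent_points_def flat_dim_fl)
  have "cvec.dim (hom ` set zs) \<le> card (set zs)"
    using cvec.dim_le_card'[of "hom ` set zs"] card_image_le[of "set zs" hom] by simp
  then have card: "card (set zs) = length zs" using dim card_length[of zs] by simp
  have "hom u \<notin> cvec.span (hom ` set zs)" using u(2) by (simp add: mem_fl_iff)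
  then have "flat_dim (fl (insert u (set zs))) = int (length zs)"
    using dim_insert_new[of "hom ` set zs" "hom u"] dim by (simp add: flat_dim_fl)
  moreover have "caffine (cspace d)" by (auto simp: caffine_def cspace_def cscale_def)
  then have "fl (insert u (set zs)) \<subseteq> cspace d"
    using V(2) zs(1) u(1) by (intro fl_minimal) auto
  ultimately have "k_flat d (length zs) (fl (insert u (set zs)))"
    by (simp add: k_flat_def caffine_fl)
  then have ne: "card (fl (insert u (set zs)) \<inter> V) \<noteq> length zs + 1"
    using non by (simp add: elementary_def)
  have "u \<notin> set zs" using u(2) subset_fl by blast
  then have card': "card (insert u (set zs)) = length zs + 1" using card by simp
  have sub: "insert u (set zs) \<subseteq> fl (insert u (set zs)) \<inter> V"
    using subset_fl u(1) zs(1) by blast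
  have "insert u (set zs) \<noteq> fl (insert u (set zs)) \<inter> V" using ne card' by metis
  then obtain w where w: "w \<in> fl (insert u (set zs))" "w \<in> V" "w \<noteq> u" "w \<notin> set zs"
    using sub by blast
  then show ?thesis using zs(3) by blast
qed

lemma SG_affine_dim_le:
  assumes "k \<ge> 1" "0 < \<delta>" "\<delta> \<le> 1" "SG d k \<delta> V"
  shows "real_of_int (affine_dim V) \<le> 39 ^ k / \<delta>"
  using assms
proof (induction k arbitrary: \<delta> V rule: dec_induct)
  case base
  note \<delta> = base(1,2)
  have V: "finite V" "V \<subseteq> cspace d" using base by (auto simp: SG_def)
  have "SG_star d 1 \<delta> V"
    unfolding SG_star_def
  proof (intro conjI V allI impI)
    fix vs assume vs: "length vs = 1 \<and> set vs \<subseteq> V \<and> independent_points vs"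
    then obtain v where v: "vs = [v]" by (cases vs) auto
    have "\<delta> * real (card V) \<le> real (card {u \<in> V. u \<in> fl (set vs) \<or> \<not> elementary d 1 V (fl (insert u (set vs)))})"
      using base(3) vs unfolding SG_def by blast
    also have "\<dots> \<le> real (card {u \<in> V. u \<in> fl (set vs) \<or>
        (\<exists>w\<in>V. w \<in> fl (insert u (set vs)) \<and> w \<notin> fl (set vs) \<union> {u})})"
    proof (intro of_nat_mono card_mono subsetI)
      show "finite {u \<in> V. u \<in> fl (set vs) \<or> (\<exists>w\<in>V. w \<in> fl (insert u (set vs)) \<and> w \<notin> fl (set vs) \<union> {u})}"
        using V by simp
      fix u assume u: "u \<in> {u \<in> V. u \<in> fl (set vs) \<or> \<not> elementary d 1 V (fl (insert u (set vs)))}"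
      \<comment> \<open>The flat of one point is that point, so for \<open>k = 1\<close> the smaller
        flat cannot hide further points.\<close>
      have "V \<inter> fl (set vs) = set vs" using vs v by (auto simp: fl_singleton)
      then show "u \<in> {u \<in> V. u \<in> fl (set vs) \<or> (\<exists>w\<in>V. w \<in> fl (insert u (set vs)) \<and> w \<notin> fl (set vs) \<union> {u})}"
        using non_elementary_witness[OF V, of vs u] u vs by auto
    qed
    finally show "\<delta> * real (card V) \<le> real (card {u \<in> V. u \<in> fl (set vs) \<or>
        (\<exists>w\<in>V. w \<in> fl (insert u (set vs)) \<and> w \<notin> fl (set vs) \<union> {u})})" .
  qed
  then have "real_of_int (affine_dim V) \<le> 13 / \<delta>" using SG_star_affine_dim_le[of d 1 \<delta> V] \<delta> by simp
  also have "\<dots> \<le> 39 ^ 1 / \<delta>" using \<delta> by (simp add: divide_right_mono)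
  finally show ?case by simp
next
  case (step k)
  note \<delta> = step.prems(1,2) and SG = step.prems(3)
  have V: "finite V" "V \<subseteq> cspace d" using SG by (auto simp: SG_def)
  \<comment> \<open>A flat spanned by \<open>K\<close> independent points is too large for its points to form a 1-SG
    configuration of order \<open>k\<close>, so it contains an elementary \<open>k\<close>-flat.\<close>
  define K :: nat where "K = 39 ^ k + 2"
  have "SG_star d K \<delta> V"
    unfolding SG_star_def
  proof (intro conjI V allI impI)
    fix vs assume vs: "length vs = K \<and> set vs \<subseteq> V \<and> independent_points vs"
    define F where "F = fl (set vs)"
    define V' where "V' = V \<inter> F"
    have V': "finite V'" "V' \<subseteq> cspace d" "V' \<subseteq> V" using V by (auto simp: V'_def)
    have "set vs \<subseteq> V'" using vs subset_fl by (auto simp: V'_def F_def)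
    then have "F \<subseteq> fl V'" using subset_fl[of V'] unfolding F_def by (intro fl_minimal caffine_fl) auto
    moreover have "fl V' \<subseteq> F" unfolding F_def by (intro fl_minimal caffine_fl) (auto simp: V'_def F_def)
    \<comment> \<open>A flat of \<open>K\<close> independent points has dimension
      \<open>K - 1\<close>, so the summand 2 in \<open>K\<close> makes the dimension exceed
      \<open>39 ^ k\<close> by one.\<close>
    ultimately have "affine_dim V' = int (39 ^ k + 1)"
      using vs by (simp add: affine_dim_def independent_points_def F_def K_def)
    then have "\<not> SG d k 1 V'" using step.IH[of 1 V'] by auto
    \<comment> \<open>With the density 1, a single point missing from the count violates the
      condition; that point \<open>u0\<close> completes \<open>ys\<close> to an elementary
      flat.\<close>
    then obtain ys where ys: "length ys = k" "set ys \<subseteq> V'" "independent_points ys"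
      and few: "card {u \<in> V'. u \<in> fl (set ys) \<or> \<not> elementary d k V' (fl (insert u (set ys)))} < card V'"
      using V' unfolding SG_def by auto
    have "{u \<in> V'. u \<in> fl (set ys) \<or> \<not> elementary d k V' (fl (insert u (set ys)))} \<noteq> V'"
      using few by (metis less_irrefl)
    then obtain u0 where u0: "u0 \<in> V'" "u0 \<notin> fl (set ys)" "elementary d k V' (fl (insert u0 (set ys)))"
      by blast
    define zs where "zs = u0 # ys"
    have len: "length zs = Suc k" by (simp add: zs_def ys)
    have elem: "elementary d k V' (fl (set zs))" using u0 by (simp add: zs_def)
    then have indep: "independent_points zs"
      by (simp add: elementary_def k_flat_def independent_points_def len)
    have zsV': "set zs \<subseteq> V'" using u0 ys by (simp add: zs_def)
    have zsF: "fl (set zs) \<subseteq> F" unfolding F_def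
      using zsV' by (intro fl_minimal caffine_fl) (auto simp: V'_def F_def)
    \<comment> \<open>Both sides have \<open>k + 1\<close> points: the list is independent, hence
      without repetitions, and its flat is elementary.\<close>
    have "set zs = fl (set zs) \<inter> V'"
    proof (rule card_subset_eq)
      show "finite (fl (set zs) \<inter> V')" using V' by simp
      show "set zs \<subseteq> fl (set zs) \<inter> V'" using zsV' subset_fl by blast
      have "cvec.dim (hom ` set zs) = length zs"
        using indep by (simp add: independent_points_def flat_dim_fl)
      moreover have "cvec.dim (hom ` set zs) \<le> card (set zs)"
        using cvec.dim_le_card'[of "hom ` set zs"] card_image_le[of "set zs" hom] by simp
      ultimately have "card (set zs) = Suc k" using card_length[of zs] len by simp
      then show "card (set zs) = card (fl (set zs) \<inter> V')" using elem by (simp add: elementary_def)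
    qed
    then have alone: "V \<inter> fl (set zs) = set zs" using zsF by (auto simp: V'_def)
    have zsV: "set zs \<subseteq> V" using zsV' V' by blast
    have "\<delta> * real (card V) \<le> real (card {u \<in> V. u \<in> fl (set zs) \<or> \<not> elementary d (Suc k) V (fl (insert u (set zs)))})"
      using SG len zsV indep unfolding SG_def by blast
    also have "\<dots> \<le> real (card {u \<in> V. u \<in> fl (set vs) \<or>
        (\<exists>w\<in>V. w \<in> fl (insert u (set vs)) \<and> w \<notin> fl (set vs) \<union> {u})})"
    proof (intro of_nat_mono card_mono subsetI)
      show "finite {u \<in> V. u \<in> fl (set vs) \<or> (\<exists>w\<in>V. w \<in> fl (insert u (set vs)) \<and> w \<notin> fl (set vs) \<union> {u})}"
        using V by simp
      fix u assume u: "u \<in> {u \<in> V. u \<in> fl (set zs) \<or> \<not> elementary d (Suc k) V (fl (insert u (set zs)))}"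
      have "\<exists>w\<in>V. w \<in> fl (insert u (set vs)) \<and> w \<notin> F \<union> {u}" if uF: "u \<notin> F"
      proof -
        have "u \<notin> fl (set zs)" using uF zsF by blast
        then obtain w where w: "w \<in> V" "w \<in> fl (insert u (set zs))" "w \<notin> fl (set zs)" "w \<noteq> u"
          using non_elementary_witness[OF V zsV indep alone, of u] u len by auto
        have "set zs \<subseteq> fl (insert u (set vs))"
        proof -
          have "F \<subseteq> fl (insert u (set vs))"
            unfolding F_def using subset_fl[of "insert u (set vs)"] by (intro fl_minimal caffine_fl) auto
          then show ?thesis using zsF subset_fl[of "set zs"] by blast
        qed
        then have "fl (insert u (set zs)) \<subseteq> fl (insert u (set vs))"
          using subset_fl[of "insert u (set vs)"] by (intro fl_minimal caffine_fl) auto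
        \<comment> \<open>If \<open>w\<close> were in \<open>F\<close>, exchanging it with
          \<open>u\<close> over \<open>zs\<close> would put \<open>u\<close> into the flat of
          \<open>w\<close> and \<open>zs\<close>, hence into \<open>F\<close>.\<close>
        moreover have "w \<notin> F"
        proof
          assume "w \<in> F"
          then have "fl (insert w (set zs)) \<subseteq> F"
            unfolding F_def using zsF subset_fl[of "set zs"] by (intro fl_minimal caffine_fl) (auto simp: F_def)
          then show False using fl_insert_exchange[OF w(2,3)] uF by blast
        qed
        ultimately show ?thesis using w by blast
      qed
      then show "u \<in> {u \<in> V. u \<in> fl (set vs) \<or> (\<exists>w\<in>V. w \<in> fl (insert u (set vs)) \<and> w \<notin> fl (set vs) \<union> {u})}"
        using u unfolding F_def by blast
    qed
    finally show "\<delta> * real (card V) \<le> real (card {u \<in> V. u \<in> fl (set vs) \<or>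
        (\<exists>w\<in>V. w \<in> fl (insert u (set vs)) \<and> w \<notin> fl (set vs) \<union> {u})})" .
  qed
  then have "real_of_int (affine_dim V) \<le> 13 * real K / \<delta>"
    using SG_star_affine_dim_le[of d K \<delta> V] \<delta> by (simp add: K_def)
  \<comment> \<open>The factor 3 between 13 and 39 absorbs the summand 2 in \<open>K\<close>,
    because \<open>2 \<le> 2 * 39 ^ k\<close>.\<close>
  also have "13 * real K \<le> 39 ^ Suc k"
    using one_le_power[of "39::real" k] by (simp add: K_def)
  finally show ?case using \<delta> by (simp add: divide_right_mono)
qed

theorem theorem1p14:
  "\<exists>C::real. C > 0 \<and>
     (\<forall>(k::nat) (\<delta>::real) (d::nat). k \<ge> 1 \<longrightarrow> 0 < \<delta> \<longrightarrow> \<delta> \<le> 1 \<longrightarrow>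
        (\<forall>V. SG_star d k \<delta> V \<longrightarrow> real_of_int (affine_dim V) \<le> C * real k / \<delta>) \<and>
        (\<forall>V. SG d k \<delta> V \<longrightarrow> real_of_int (affine_dim V) \<le> C ^ k / \<delta>))"
  \<comment> \<open>\<open>13 * (39 ^ (k - 1) + 2) \<le> 39 ^ k\<close>\<close>
proof (intro exI[of _ 39] conjI allI impI)
  fix k :: nat and \<delta> :: real and d :: nat and V
  assume k: "1 \<le> k" and \<delta>: "0 < \<delta>" "\<delta> \<le> 1"
  {
    assume "SG_star d k \<delta> V"
    from SG_star_affine_dim_le[OF this k \<delta>]
    have "real_of_int (affine_dim V) \<le> 13 * real k / \<delta>" .
    also have "\<dots> \<le> 39 * real k / \<delta>" using \<delta> by (intro divide_right_mono) auto
    finally show "real_of_int (affine_dim V) \<le> 39 * real k / \<delta>" .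
  next
    assume "SG d k \<delta> V"
    then show "real_of_int (affine_dim V) \<le> 39 ^ k / \<delta>" using SG_affine_dim_le k \<delta> by blast
  }
qed simp

end
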